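(* Let $d\ge1$ be an integer, let $m>0$, $m\ne1$, with $3-d+dm\neq0$, set $A=\frac{1+d-dm}{3-d+dm}$, and let $\gamma\in\mathbb R$ with $(1-m)\gamma>0$. Then the function $$g_\gamma(x,v):=\left(\tfrac{1-m}m\left(\gamma+\tfrac{1+A}2|v|^2+\tfrac{1+A}2A|x|^2\right)\right)_+^{\frac1{m-1}}$$ belongs to $L^1(\mathbb R^d\times\mathbb R^d)$ if and only if $m\in\left(1-\frac1d,1\right)\cup\left(1,1+\frac1d\right)$. Moreover, for $m$ in that range, the equation $$\partial_t f+v\cdot\nabla_x f=\Delta_v f^m$$ admits a fundamental solution, which is given for $t>0$ by $$f_\star(t,x,v)=R(t)^{-d(1+A)}\,g_{\gamma_\star}\left(\frac{x}{R(t)},\frac{v}{R(t)^A}-\frac{x}{R(t)}\right),\qquad R(t)=\big((1-A)t\big)^{\frac1{1-A}},$$ where $\gamma_\star$ is the real number with $(1-m)\gamma_\star>0$ and $\iint_{\mathbb R^d\times\mathbb R^d}g_{\gamma_\star}\,dx\,dv=1$.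
   Context: $(\cdot)_+$ denotes the positive part. A fundamental solution here means a nonnegative solution $f$ of the equation on $(0,+\infty)\times\mathbb R^d\times\mathbb R^d$ in the sense of distributions, with finite mass (here equal to $1$), whose initial datum is the Dirac distribution at $(x,v)=(0,0)$, i.e. $f(t,\cdot,\cdot)\,dx\,dv$ converges weakly (against bounded continuous functions) to $\boldsymbol\delta_{(0,0)}$ as $t\to0^+$. *)

theory Defs
  imports "HOL-Analysis.Analysis"
begin

text \<open>Here the space \<open>R^d\<close> is \<open>real^'n\<close> with \<open>d = CARD('n)\<close>. Phase space points are pairs
  \<open>(x, v)\<close> and space-time points are triples \<open>(t, x, v)\<close>.\<close>

definition profile :: "real \<Rightarrow> real \<Rightarrow> real \<Rightarrow> real^'n \<Rightarrow> real^'n \<Rightarrow> real" where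
  "profile m A \<gamma> x v =
     (max 0 ((1 - m) / m * (\<gamma> + (1 + A) / 2 * (norm v)\<^sup>2 + (1 + A) / 2 * A * (norm x)\<^sup>2)))
       powr (1 / (m - 1))"

text \<open>Pitfall: \<open>0 powr a = 0\<close> also for \<open>a < 0\<close>, so for \<open>m < 1\<close> the profile is \<open>0\<close>, not infinite,
  where the positive part vanishes. That set is empty if \<open>1 - 1/d < m < 1\<close> and \<open>\<gamma> > 0\<close>. In the
  other cases with \<open>m < 1\<close> the profile is pointwise at most the one with values in \<open>[0, \<infinity>]\<close>, so
  its non-integrability implies that of the latter.\<close>

definition scale :: "real \<Rightarrow> real \<Rightarrow> real" where
  "scale A t = ((1 - A) * t) powr (1 / (1 - A))"

definition self_similar :: "real \<Rightarrow> real \<Rightarrow> real \<Rightarrow> real \<Rightarrow> real^'n \<Rightarrow> real^'n \<Rightarrow> real" where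
  "self_similar m A \<gamma> t x v =
     scale A t powr (- real CARD('n) * (1 + A)) *
     profile m A \<gamma> (x /\<^sub>R scale A t) (v /\<^sub>R (scale A t powr A) - x /\<^sub>R scale A t)"

primrec continuously_differentiable ::
    "nat \<Rightarrow> ('a::real_normed_vector \<Rightarrow> real) \<Rightarrow> bool" where
  "continuously_differentiable 0 f \<longleftrightarrow> continuous_on UNIV f"
| "continuously_differentiable (Suc k) f \<longleftrightarrow>
     (\<forall>z. f differentiable (at z)) \<and>
     (\<forall>h. continuously_differentiable k (\<lambda>z. frechet_derivative f (at z) h))"

abbreviation positive_times :: "(real \<times> (real^'n) \<times> (real^'n)) set" where
  "positive_times \<equiv> {0<..} \<times> UNIV"

text \<open>Smooth functions with compact support in the open set \<open>positive_times\<close>, extended by zero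
  to the whole space.\<close>

definition test_function :: "(real \<times> (real^'n) \<times> (real^'n) \<Rightarrow> real) \<Rightarrow> bool" where
  "test_function \<phi> \<longleftrightarrow>
     (\<forall>k. continuously_differentiable k \<phi>) \<and>
     compact (closure {z. \<phi> z \<noteq> 0}) \<and> closure {z. \<phi> z \<noteq> 0} \<subseteq> positive_times"

definition partial_t ::
    "(real \<times> (real^'n) \<times> (real^'n) \<Rightarrow> real) \<Rightarrow> real \<times> (real^'n) \<times> (real^'n) \<Rightarrow> real" where
  "partial_t \<phi> = (\<lambda>(t, x, v). deriv (\<lambda>s. \<phi> (s, x, v)) t)"

definition partial_x ::
    "'n \<Rightarrow> (real \<times> (real^'n) \<times> (real^'n) \<Rightarrow> real) \<Rightarrow> real \<times> (real^'n) \<times> (real^'n) \<Rightarrow> real" where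
  "partial_x i \<phi> = (\<lambda>(t, x, v). deriv (\<lambda>h. \<phi> (t, x + h *\<^sub>R axis i 1, v)) 0)"

definition partial_v ::
    "'n \<Rightarrow> (real \<times> (real^'n) \<times> (real^'n) \<Rightarrow> real) \<Rightarrow> real \<times> (real^'n) \<times> (real^'n) \<Rightarrow> real" where
  "partial_v i \<phi> = (\<lambda>(t, x, v). deriv (\<lambda>h. \<phi> (t, x, v + h *\<^sub>R axis i 1)) 0)"

definition transport ::
    "(real \<times> (real^'n) \<times> (real^'n) \<Rightarrow> real) \<Rightarrow> real \<times> (real^'n) \<times> (real^'n) \<Rightarrow> real" where
  "transport \<phi> = (\<lambda>(t, x, v). \<Sum>i\<in>UNIV. v $ i * partial_x i \<phi> (t, x, v))"

definition laplacian_v ::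
    "(real \<times> (real^'n) \<times> (real^'n) \<Rightarrow> real) \<Rightarrow> real \<times> (real^'n) \<times> (real^'n) \<Rightarrow> real" where
  "laplacian_v \<phi> z = (\<Sum>i\<in>UNIV. partial_v i (partial_v i \<phi>) z)"

definition locally_integrable :: "(real \<times> (real^'n) \<times> (real^'n) \<Rightarrow> real) \<Rightarrow> bool" where
  "locally_integrable u \<longleftrightarrow>
     (\<forall>K. compact K \<and> K \<subseteq> positive_times \<longrightarrow> set_integrable lborel K u)"

text \<open>The equation \<open>\<partial>_t f + v \<bullet> \<nabla>_x f = \<Delta>_v (f^m)\<close> for positive times, in the sense of
  distributions. Since \<open>v\<close> does not depend on \<open>x\<close>, the formal adjoint of \<open>\<partial>_t + v \<bullet> \<nabla>_x\<close> is its
  negative. It is meant for nonnegative \<open>f\<close>, so that \<open>powr\<close> is the usual power.\<close>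

definition distributional_solution ::
    "real \<Rightarrow> (real \<Rightarrow> real^'n \<Rightarrow> real^'n \<Rightarrow> real) \<Rightarrow> bool" where
  "distributional_solution m f \<longleftrightarrow>
     locally_integrable (\<lambda>(t, x, v). f t x v) \<and>
     locally_integrable (\<lambda>(t, x, v). f t x v powr m) \<and>
     (\<forall>\<phi>. test_function \<phi> \<longrightarrow>
        - (LINT (t, x, v):positive_times|lborel.
             f t x v * (partial_t \<phi> (t, x, v) + transport \<phi> (t, x, v)))
        = (LINT (t, x, v):positive_times|lborel. f t x v powr m * laplacian_v \<phi> (t, x, v)))"

definition fundamental_solution ::
    "real \<Rightarrow> (real \<Rightarrow> real^'n \<Rightarrow> real^'n \<Rightarrow> real) \<Rightarrow> bool" where
  "fundamental_solution m f \<longleftrightarrow>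
     (\<forall>t>0. \<forall>x v. 0 \<le> f t x v) \<and>
     distributional_solution m f \<and>
     (\<forall>t>0. has_bochner_integral lborel (\<lambda>(x, v). f t x v) 1) \<and>
     (\<forall>\<psi> :: (real^'n) \<times> (real^'n) \<Rightarrow> real.
        continuous_on UNIV \<psi> \<and> bounded (range \<psi>) \<longrightarrow>
        ((\<lambda>t. LINT (x, v)|lborel. f t x v * \<psi> (x, v)) \<longlongrightarrow> \<psi> (0, 0)) (at_right 0))"

end

theory Submission
  imports Defs
begin

text \<open>
  Put \<open>R = scale A t\<close>, so that \<open>R' = R powr A\<close>, and use the similarity variables \<open>y = x / R\<close> and
  \<open>w = v / R powr A - x / R\<close>. Write \<open>Q(y, w) = norm w ^ 2 + A * norm y ^ 2\<close> for the quadratic form in the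
  profile \<open>g\<close>.

  \<^bold>\<open>Nonlinear diffusion becomes transport.\<close> The power \<open>g powr m\<close> is differentiable, also across the
  boundary of the support when \<open>m > 1\<close>, because there it is a power of a positive part with exponent
  \<open>m / (m - 1) > 1\<close>. Its gradient in \<open>w\<close> is \<open>- (1 + A) * g *\<^sub>R w\<close>, a vector field times \<open>g\<close> itself, which
  is the special feature of the profile. Undoing the scaling, the gradient of \<open>f powr m\<close> in \<open>v\<close> is
  \<open>- f\<close> times \<open>acceleration\<close>; the powers of \<open>R\<close> match because
  \<open>(1 + A) * (1 - m) * d = 3 * A - 1\<close>. One integration by parts in \<open>v\<close>
  (\<open>self_similar_diffusion\<close>) therefore turns the equation into the linear continuity equation for the field
  \<open>x' = v\<close>, \<open>v' = acceleration\<close>.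

  \<^bold>\<open>The transport equation is solved by characteristics.\<close> In the similarity variables and in the time
  \<open>ln R\<close> the field is the harmonic oscillator \<open>y' = w\<close>, \<open>w' = - A *\<^sub>R y\<close>, which preserves \<open>Q\<close> and Lebesgue
  measure. So there is an explicit linear flow with determinant \<open>R powr (1 + A)\<close> in each pair of
  coordinates, and \<open>f(t)\<close> is the image of \<open>g\<close> under it (\<open>integral_self_similar\<close>). All claims about \<open>f\<close>
  are read off from this: the mass is that of \<open>g\<close>; \<open>f(t)\<close> concentrates at the origin because the flow
  tends to \<open>0\<close> as \<open>t\<close> does (\<open>self_similar_concentrates\<close>); and after Fubini the weak continuity equation
  is the integral of the time derivative of the test function along a single characteristic, which
  vanishes (\<open>self_similar_transport\<close>). Since no derivative of \<open>f\<close> itself is taken, the fast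
  (\<open>m < 1\<close>) and slow (\<open>m > 1\<close>) diffusion ranges are treated alike.

  \<^bold>\<open>Integrability and mass\<close> come from dilations. Outside the range of \<open>m\<close>, the profile, or its restriction
  to a cone, dominates itself too strongly under a dilation to have a finite integral
  (\<open>not_integrable_if_superscaling\<close>). Inside the range \<open>A\<close> is positive and the profile is compactly
  supported or a power of a coercive quadratic function with enough decay (\<open>integrable_profile\<close>).
  A dilation changes \<open>\<gamma>\<close> into a multiple and the mass by a nonzero power of the same factor, so
  exactly one \<open>\<gamma>\<close> has mass \<open>1\<close> (\<open>exists_unique_unit_mass\<close>).
\<close>

section \<open>Linear maps acting on pairs of vectors\<close>

text \<open>Every change of variables on phase space below, the anisotropic dilations as well as the
  characteristic flow, is a two by two matrix of scalars that acts on all pairs \<open>(x $ i, v $ i)\<close> at once.\<close>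

definition block_map :: "real \<Rightarrow> real \<Rightarrow> real \<Rightarrow> real \<Rightarrow> 'a \<times> 'a \<Rightarrow> 'a \<times> 'a::real_vector" where
  "block_map a b c e = (\<lambda>(x, v). (a *\<^sub>R x + b *\<^sub>R v, c *\<^sub>R x + e *\<^sub>R v))"

lemma continuous_block_map [continuous_intros]:
  "continuous_on S (block_map a b c e :: 'a \<times> 'a \<Rightarrow> 'a \<times> 'a::real_normed_vector)"
  unfolding block_map_def case_prod_beta by (intro continuous_intros)

lemma measurable_block_map [measurable]:
  "(block_map a b c e :: 'a \<times> 'a \<Rightarrow> 'a \<times> 'a::euclidean_space) \<in> borel_measurable borel"
  by (intro borel_measurable_continuous_onI continuous_intros)

lemma nn_integral_affine:
  fixes f :: "'a::euclidean_space \<Rightarrow> ennreal"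
  assumes [measurable]: "f \<in> borel_measurable borel" and "c \<noteq> 0"
  shows "ennreal (\<bar>c\<bar> ^ DIM('a)) * (\<integral>\<^sup>+x. f (c *\<^sub>R x + t) \<partial>lborel) = (\<integral>\<^sup>+x. f x \<partial>lborel)"
proof -
  have "(\<integral>\<^sup>+x. f x \<partial>lborel) =
      (\<integral>\<^sup>+x. f x \<partial>density (distr lborel borel (\<lambda>x. t + c *\<^sub>R x)) (\<lambda>_. \<bar>c\<bar> ^ DIM('a)))"
    using lborel_affine[OF \<open>c \<noteq> 0\<close>, of t] by simp
  also have "\<dots> = ennreal (\<bar>c\<bar> ^ DIM('a)) * (\<integral>\<^sup>+x. f (c *\<^sub>R x + t) \<partial>lborel)"
    by (simp add: nn_integral_density nn_integral_distr nn_integral_cmult add.commute)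
  finally show ?thesis by simp
qed

lemma nn_integral_lborel_pair:
  fixes f :: "'a::euclidean_space \<times> 'b::euclidean_space \<Rightarrow> ennreal"
  assumes "f \<in> borel_measurable borel"
  shows "(\<integral>\<^sup>+z. f z \<partial>lborel) = (\<integral>\<^sup>+v. \<integral>\<^sup>+x. f (x, v) \<partial>lborel \<partial>lborel)"
    and "(\<integral>\<^sup>+z. f z \<partial>lborel) = (\<integral>\<^sup>+x. \<integral>\<^sup>+v. f (x, v) \<partial>lborel \<partial>lborel)"
proof -
  have f: "f \<in> borel_measurable (lborel \<Otimes>\<^sub>M lborel)"
    using assms by (simp add: lborel_prod)
  show "(\<integral>\<^sup>+z. f z \<partial>lborel) = (\<integral>\<^sup>+v. \<integral>\<^sup>+x. f (x, v) \<partial>lborel \<partial>lborel)"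
    using lborel_pair.nn_integral_snd[OF f] by (simp add: lborel_prod)
  show "(\<integral>\<^sup>+z. f z \<partial>lborel) = (\<integral>\<^sup>+x. \<integral>\<^sup>+v. f (x, v) \<partial>lborel \<partial>lborel)"
    using lborel.nn_integral_fst[OF f] by (simp add: lborel_prod)
qed

text \<open>If the upper left entry is not \<open>0\<close>, the matrix factors into a map that changes only the first
  component and one that changes only the second, so two affine substitutions, each with the other
  variable frozen, give the determinant.\<close>

lemma nn_integral_block_map_aux:
  fixes f :: "'a \<times> 'a::euclidean_space \<Rightarrow> ennreal"
  assumes f [measurable]: "f \<in> borel_measurable borel" and "a * e - b * c \<noteq> 0" and "a \<noteq> 0"
  shows "ennreal (\<bar>a * e - b * c\<bar> ^ DIM('a)) * (\<integral>\<^sup>+z. f (block_map a b c e z) \<partial>lborel) =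
    (\<integral>\<^sup>+z. f z \<partial>lborel)"
proof -
  define \<Delta> where "\<Delta> = a * e - b * c"
  have [measurable]: "f \<in> borel_measurable (borel \<Otimes>\<^sub>M borel)"
    by (simp add: borel_prod)
  have "ennreal (\<bar>\<Delta>\<bar> ^ DIM('a)) * (\<integral>\<^sup>+z. f (block_map a b c e z) \<partial>lborel) =
     ennreal (\<bar>\<Delta> / a\<bar> ^ DIM('a)) * (ennreal (\<bar>a\<bar> ^ DIM('a)) * (\<integral>\<^sup>+z. f (block_map a b c e z) \<partial>lborel))"
    using \<open>a \<noteq> 0\<close> by (simp add: mult.assoc[symmetric] ennreal_mult[symmetric] power_mult_distrib[symmetric])
  also have "ennreal (\<bar>a\<bar> ^ DIM('a)) * (\<integral>\<^sup>+z. f (block_map a b c e z) \<partial>lborel) =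
     (\<integral>\<^sup>+v. ennreal (\<bar>a\<bar> ^ DIM('a)) * (\<integral>\<^sup>+x. f (a *\<^sub>R x + b *\<^sub>R v, c *\<^sub>R x + e *\<^sub>R v) \<partial>lborel) \<partial>lborel)"
    by (subst nn_integral_lborel_pair(1), measurable) (simp add: nn_integral_cmult block_map_def)
  also have "\<dots> = (\<integral>\<^sup>+v. \<integral>\<^sup>+y. f (y, (c / a) *\<^sub>R y + (\<Delta> / a) *\<^sub>R v) \<partial>lborel \<partial>lborel)"
  proof (intro nn_integral_cong)
    fix v :: 'a
    have "c *\<^sub>R x + e *\<^sub>R v = (c / a) *\<^sub>R (a *\<^sub>R x + b *\<^sub>R v) + (\<Delta> / a) *\<^sub>R v" for x
    proof -
      have "e = c / a * b + \<Delta> / a" using \<open>a \<noteq> 0\<close> by (simp add: \<Delta>_def field_simps)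
      then have "e *\<^sub>R v = (c / a * b) *\<^sub>R v + (\<Delta> / a) *\<^sub>R v" by (metis scaleR_add_left)
      then show ?thesis using \<open>a \<noteq> 0\<close> by (simp add: scaleR_add_right)
    qed
    then show "ennreal (\<bar>a\<bar> ^ DIM('a)) * (\<integral>\<^sup>+x. f (a *\<^sub>R x + b *\<^sub>R v, c *\<^sub>R x + e *\<^sub>R v) \<partial>lborel) =
        (\<integral>\<^sup>+y. f (y, (c / a) *\<^sub>R y + (\<Delta> / a) *\<^sub>R v) \<partial>lborel)"
      using nn_integral_affine[of "\<lambda>y. f (y, (c / a) *\<^sub>R y + (\<Delta> / a) *\<^sub>R v)" a "b *\<^sub>R v"] \<open>a \<noteq> 0\<close>
      by simp
  qed
  also have "\<dots> = (\<integral>\<^sup>+y. \<integral>\<^sup>+v. f (y, (c / a) *\<^sub>R y + (\<Delta> / a) *\<^sub>R v) \<partial>lborel \<partial>lborel)"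
    by (rule lborel_pair.Fubini') measurable
  also have "ennreal (\<bar>\<Delta> / a\<bar> ^ DIM('a)) * \<dots> =
     (\<integral>\<^sup>+y. ennreal (\<bar>\<Delta> / a\<bar> ^ DIM('a)) * (\<integral>\<^sup>+v. f (y, (\<Delta> / a) *\<^sub>R v + (c / a) *\<^sub>R y) \<partial>lborel) \<partial>lborel)"
    by (subst nn_integral_cmult[symmetric]) (simp_all add: add.commute)
  also have "\<dots> = (\<integral>\<^sup>+y. \<integral>\<^sup>+v. f (y, v) \<partial>lborel \<partial>lborel)"
    using assms \<open>a \<noteq> 0\<close> by (intro nn_integral_cong nn_integral_affine) (auto simp: \<Delta>_def)
  also have "\<dots> = (\<integral>\<^sup>+z. f z \<partial>lborel)"
    using f by (rule nn_integral_lborel_pair(2)[symmetric])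
  finally show ?thesis unfolding \<Delta>_def .
qed

text \<open>A vanishing upper left entry is moved away by exchanging the two arguments, which is Fubini.\<close>

lemma nn_integral_block_map:
  fixes f :: "'a \<times> 'a::euclidean_space \<Rightarrow> ennreal"
  assumes f [measurable]: "f \<in> borel_measurable borel" and \<Delta>: "a * e - b * c \<noteq> 0"
  shows "ennreal (\<bar>a * e - b * c\<bar> ^ DIM('a)) * (\<integral>\<^sup>+z. f (block_map a b c e z) \<partial>lborel) =
    (\<integral>\<^sup>+z. f z \<partial>lborel)"
proof (cases "a = 0")
  case False
  then show ?thesis using nn_integral_block_map_aux assms by blast
next
  case True
  have [measurable]: "f \<in> borel_measurable (borel \<Otimes>\<^sub>M borel)"
    by (simp add: borel_prod)
  have "(\<integral>\<^sup>+z. f (block_map a b c e z) \<partial>lborel) = (\<integral>\<^sup>+z. f (block_map b a e c z) \<partial>lborel)"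
    by (subst nn_integral_lborel_pair(1), measurable, subst nn_integral_lborel_pair(2), measurable)
      (simp add: block_map_def add.commute)
  moreover have "\<bar>a * e - b * c\<bar> = \<bar>b * c - a * e\<bar>" by simp
  ultimately show ?thesis
    using nn_integral_block_map_aux[OF f, of b c a e] \<Delta> True by (simp add: mult.commute)
qed

lemma lborel_block_map:
  assumes "a * e - b * c \<noteq> 0"
  shows "lborel = density (distr lborel borel (block_map a b c e :: 'a \<times> 'a \<Rightarrow> 'a \<times> 'a::euclidean_space))
     (\<lambda>_. ennreal (\<bar>a * e - b * c\<bar> ^ DIM('a)))" (is "_ = ?D")
proof (rule measure_eqI)
  fix S :: "('a \<times> 'a) set" assume "S \<in> sets lborel"
  then have [measurable]: "S \<in> sets borel" by simp
  have "emeasure (distr lborel borel (block_map a b c e)) S =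
      (\<integral>\<^sup>+z. indicator S (block_map a b c e z :: 'a \<times> 'a) \<partial>lborel)"
    by (subst nn_integral_distr[of _ _ borel, symmetric]) auto
  then show "emeasure lborel S = emeasure ?D S"
    using nn_integral_block_map[of "indicator S" a e b c] assms
    by (simp add: emeasure_density nn_integral_cmult nn_integral_distr)
qed simp

lemma integral_block_map:
  fixes f :: "'a \<times> 'a::euclidean_space \<Rightarrow> real"
  assumes [measurable]: "f \<in> borel_measurable borel" and \<Delta>: "a * e - b * c \<noteq> 0"
  shows "integrable lborel (\<lambda>z. f (block_map a b c e z)) \<longleftrightarrow> integrable lborel f"
    and "\<bar>a * e - b * c\<bar> ^ DIM('a) * (LINT z|lborel. f (block_map a b c e z)) = (LINT z|lborel. f z)"
proof -
  let ?D = "distr lborel borel (block_map a b c e :: 'a \<times> 'a \<Rightarrow> 'a \<times> 'a)"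
  have "integrable lborel f \<longleftrightarrow> integrable ?D (\<lambda>z. \<bar>a * e - b * c\<bar> ^ DIM('a) * f z)"
    by (subst lborel_block_map[OF \<Delta>], subst integrable_density) auto
  also have "\<dots> \<longleftrightarrow> integrable lborel (\<lambda>z. \<bar>a * e - b * c\<bar> ^ DIM('a) * f (block_map a b c e z))"
    by (subst integrable_distr_eq) auto
  finally show "integrable lborel (\<lambda>z. f (block_map a b c e z)) \<longleftrightarrow> integrable lborel f"
    using \<Delta> by simp
  have "(LINT z|lborel. f z) = (LINT z|?D. \<bar>a * e - b * c\<bar> ^ DIM('a) * f z)"
    by (subst lborel_block_map[OF \<Delta>], subst integral_density) auto
  also have "\<dots> = (LINT z|lborel. \<bar>a * e - b * c\<bar> ^ DIM('a) * f (block_map a b c e z))"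
    by (subst integral_distr) auto
  finally show "\<bar>a * e - b * c\<bar> ^ DIM('a) * (LINT z|lborel. f (block_map a b c e z)) = (LINT z|lborel. f z)"
    by simp
qed

lemma integral_pos_if_pos_on_open:
  fixes f :: "'a::euclidean_space \<Rightarrow> real"
  assumes f: "integrable lborel f" and nonneg: "\<And>z. 0 \<le> f z"
    and U: "open U" "U \<noteq> {}" and pos: "\<And>z. z \<in> U \<Longrightarrow> 0 < f z"
  shows "0 < (LINT z|lborel. f z)"
proof (rule ccontr)
  assume "\<not> ?thesis"
  moreover have "0 \<le> (LINT z|lborel. f z)"
    using nonneg by (intro integral_nonneg_AE) simp
  ultimately have "(LINT z|lborel. f z) = 0" by simp
  then have "AE z in lborel. f z = 0"
    using integral_nonneg_eq_0_iff_AE[OF f] nonneg by simp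
  then have "AE z in lborel. z \<notin> U"
    by eventually_elim (use pos in force)
  then have "emeasure lborel U = 0"
    using U(1) by (subst (asm) AE_iff_measurable[of U]) auto
  then show False
    using open_not_negligible[OF U] U(1) by (simp add: negligible_iff_emeasure0)
qed

text \<open>For an integrable \<open>h\<close> the two sides of \<open>le\<close> would have the same integral, by the change of
  variables; but their difference is nonnegative, and positive on an open set.\<close>

lemma not_integrable_if_superscaling:
  fixes h :: "'a \<times> 'a::euclidean_space \<Rightarrow> real"
  assumes [measurable]: "h \<in> borel_measurable borel" and \<Delta>: "a * e - b * c \<noteq> 0"
    and le: "\<And>z. h z \<le> \<bar>a * e - b * c\<bar> ^ DIM('a) * h (block_map a b c e z)"
    and U: "open U" "U \<noteq> {}"
    and less: "\<And>z. z \<in> U \<Longrightarrow> h z < \<bar>a * e - b * c\<bar> ^ DIM('a) * h (block_map a b c e z)"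
  shows "\<not> integrable lborel h"
proof
  assume h: "integrable lborel h"
  define k where "k = (\<lambda>z. \<bar>a * e - b * c\<bar> ^ DIM('a) * h (block_map a b c e z) - h z)"
  have hT: "integrable lborel (\<lambda>z. h (block_map a b c e z))"
    using integral_block_map(1)[of h] h \<Delta> by simp
  have k: "integrable lborel k"
    unfolding k_def using h hT by auto
  have "(LINT z|lborel. k z) = 0"
    unfolding k_def using h hT integral_block_map(2)[of h a e b c] \<Delta> by simp
  moreover have "0 < (LINT z|lborel. k z)"
    by (rule integral_pos_if_pos_on_open[OF k _ U]) (use le less in \<open>simp_all add: k_def\<close>)
  ultimately show False by simp
qed

section \<open>Smooth test functions and integration by parts\<close>

lemma integrable_continuous_compact_support:
  fixes f :: "'a::euclidean_space \<Rightarrow> real"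
  assumes "continuous_on UNIV f" "compact K" "\<And>z. z \<notin> K \<Longrightarrow> f z = 0"
  shows "integrable lborel f"
proof -
  have "integrable lborel (\<lambda>z. indicator K z *\<^sub>R f z)"
    using assms by (intro borel_integrable_compact) (auto intro: continuous_on_subset)
  moreover have "(\<lambda>z. indicator K z *\<^sub>R f z) = f"
    using assms(3) by (auto simp: indicator_def fun_eq_iff)
  ultimately show ?thesis by simp
qed

text \<open>A solution is continuous for positive times only; its products with test functions are continuous
  everywhere.\<close>

lemma continuous_on_extend_zero:
  fixes f :: "'a::t2_space \<Rightarrow> real"
  assumes "continuous_on S f" "open S" "compact K" "K \<subseteq> S" "\<And>z. z \<notin> K \<Longrightarrow> f z = 0"
  shows "continuous_on UNIV f"
proof -
  have "continuous_on (- K) f"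
    using assms(5) by (subst continuous_on_cong[where g = "\<lambda>_. 0"]) auto
  then have "continuous_on (S \<union> - K) f"
    using assms by (intro continuous_on_open_Un) (auto simp: open_Compl compact_imp_closed)
  moreover have "S \<union> - K = UNIV" using assms(4) by auto
  ultimately show ?thesis by simp
qed

lemma lborel_integral_translation:
  fixes f :: "'a::euclidean_space \<Rightarrow> real"
  assumes [measurable]: "f \<in> borel_measurable borel"
  shows "(LINT z|lborel. f (c + z)) = (LINT z|lborel. f z)"
    and "integrable lborel (\<lambda>z. f (c + z)) \<longleftrightarrow> integrable lborel f"
  using integral_distr[of "(+) c" lborel borel f] integrable_distr_eq[of "(+) c" lborel borel f]
  by (simp_all add: lborel_distr_plus)

text \<open>The integral of \<open>H\<close> is invariant under translations along \<open>e\<close>, so all difference quotients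
  have integral \<open>0\<close>; they converge to \<open>H'\<close> boundedly and on a common compact set.\<close>

lemma integral_directional_derivative_eq_0:
  fixes H H' :: "'a::euclidean_space \<Rightarrow> real"
  assumes deriv: "\<And>z. ((\<lambda>h. H (z + h *\<^sub>R e)) has_real_derivative H' z) (at 0)"
    and H: "continuous_on UNIV H" and H': "continuous_on UNIV H'"
    and K: "compact K" and H0: "\<And>z. z \<notin> K \<Longrightarrow> H z = 0" and H'0: "\<And>z. z \<notin> K \<Longrightarrow> H' z = 0"
  shows "(LINT z|lborel. H' z) = 0"
proof -
  define \<epsilon> where "\<epsilon> n = inverse (real (Suc n))" for n
  have \<epsilon>: "0 < \<epsilon> n" "\<epsilon> n \<le> 1" for n by (auto simp: \<epsilon>_def inverse_eq_divide)
  define q where "q n z = (H (z + \<epsilon> n *\<^sub>R e) - H z) / \<epsilon> n" for n z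
  \<comment> \<open>The difference quotients vanish where the segment of length one along \<open>e\<close> misses \<open>K\<close>.\<close>
  define K' where "K' = (\<lambda>(k, s). k - s *\<^sub>R e) ` (K \<times> {0..1})"
  have K': "compact K'"
    unfolding K'_def case_prod_beta
    by (intro compact_continuous_image continuous_intros compact_Times K compact_Icc)
  have outside: "H (z + s *\<^sub>R e) = 0" if "z \<notin> K'" "s \<in> {0..1}" for z s
  proof (rule H0, rule notI)
    assume "z + s *\<^sub>R e \<in> K"
    then have "z \<in> K'"
      unfolding K'_def using that(2) by (intro image_eqI[of _ _ "(z + s *\<^sub>R e, s)"]) auto
    then show False using that by simp
  qed
  have [measurable]: "H \<in> borel_measurable borel" "H' \<in> borel_measurable borel"
    using H H' by (auto intro: borel_measurable_continuous_onI)
  have Hint: "integrable lborel H"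
    using integrable_continuous_compact_support[OF H K H0] .
  have "bounded (H' ` K)"
    using K H' by (intro compact_imp_bounded compact_continuous_image) (auto intro: continuous_on_subset)
  then obtain B0 where B0: "\<And>z. z \<in> K \<Longrightarrow> \<bar>H' z\<bar> \<le> B0"
    unfolding bounded_iff by auto
  define B where "B = max B0 0"
  have B: "\<bar>H' z\<bar> \<le> B" for z
    using B0[of z] H'0[of z] by (cases "z \<in> K") (auto simp: B_def)
  have line: "((\<lambda>h. H (z + h *\<^sub>R e)) has_real_derivative H' (z + s *\<^sub>R e)) (at s)" for z s
  proof -
    have "((\<lambda>h. H ((z + s *\<^sub>R e) + (h - s) *\<^sub>R e)) has_real_derivative H' (z + s *\<^sub>R e)) (at s)"
      using DERIV_shift[of "\<lambda>h. H ((z + s *\<^sub>R e) + (h - s) *\<^sub>R e)" "H' (z + s *\<^sub>R e)" 0 s]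
        deriv[of "z + s *\<^sub>R e"] by simp
    then show ?thesis by (simp add: algebra_simps)
  qed
  have bound: "norm (q n z) \<le> indicator K' z * B" for n z
  proof (cases "z \<in> K'")
    case False
    then show ?thesis using outside[of z "\<epsilon> n"] outside[of z 0] \<epsilon>[of n]
      by (simp add: q_def)
  next
    case True
    have "\<exists>s. 0 < s \<and> s < \<epsilon> n \<and>
        H (z + \<epsilon> n *\<^sub>R e) - H (z + 0 *\<^sub>R e) = (\<epsilon> n - 0) * H' (z + s *\<^sub>R e)"
      by (rule MVT2[OF \<epsilon>(1)]) (rule line)
    then obtain s where "H (z + \<epsilon> n *\<^sub>R e) - H z = \<epsilon> n * H' (z + s *\<^sub>R e)" by auto
    then have "q n z = H' (z + s *\<^sub>R e)" using \<epsilon>[of n] by (simp add: q_def)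
    then show ?thesis using B True by simp
  qed
  have q0: "(LINT z|lborel. q n z) = 0" for n
    unfolding q_def using Hint lborel_integral_translation[of H "\<epsilon> n *\<^sub>R e"] by (simp add: add.commute)
  have lim: "(\<lambda>n. q n z) \<longlonglongrightarrow> H' z" for z
  proof -
    have "filterlim \<epsilon> (at 0) sequentially"
      using LIMSEQ_inverse_real_of_nat \<epsilon>(1)
      unfolding filterlim_at \<epsilon>_def by (auto simp del: of_nat_Suc)
    from filterlim_compose[OF _ this] show ?thesis
      using deriv[of z] unfolding DERIV_def q_def by (simp add: filterlim_def)
  qed
  have "(\<lambda>n. LINT z|lborel. q n z) \<longlonglongrightarrow> (LINT z|lborel. H' z)"
  proof (rule integral_dominated_convergence[where w = "\<lambda>z. indicator K' z * B"])
    have "integrable lborel (\<lambda>z. indicator K' z *\<^sub>R B)"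
      using K' by (intro borel_integrable_compact) auto
    then show "integrable lborel (\<lambda>z. indicator K' z * B)" by simp
  qed (use lim bound in \<open>auto simp: q_def\<close>)
  then show ?thesis by (simp add: q0 LIMSEQ_const_iff)
qed

definition smooth :: "('a::real_normed_vector \<Rightarrow> real) \<Rightarrow> bool" where
  "smooth \<phi> \<longleftrightarrow> (\<forall>k. continuously_differentiable k \<phi>)"

lemma smooth_frechet_derivative: "smooth \<phi> \<Longrightarrow> smooth (\<lambda>z. frechet_derivative \<phi> (at z) h)"
  unfolding smooth_def by (metis continuously_differentiable.simps(2))

lemma smooth_continuous: "smooth \<phi> \<Longrightarrow> continuous_on UNIV \<phi>"
  unfolding smooth_def by (metis continuously_differentiable.simps(1))

lemma smooth_has_derivative: "smooth \<phi> \<Longrightarrow> (\<phi> has_derivative frechet_derivative \<phi> (at z)) (at z)"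
  unfolding smooth_def by (metis continuously_differentiable.simps(2) frechet_derivative_works)

lemma frechet_derivative_eq_0:
  assumes "closed K" "\<And>z. z \<notin> K \<Longrightarrow> \<phi> z = (0::real)" "z \<notin> K"
  shows "frechet_derivative \<phi> (at z) h = 0"
proof -
  have "(\<phi> has_derivative (\<lambda>_. 0)) (at z)"
    by (rule has_derivative_transform_within_open[of "\<lambda>_. 0" _ _ _ "- K"]) (use assms in auto)
  then show ?thesis by (metis frechet_derivative_at)
qed

lemma smooth_directional_derivative:
  assumes "smooth \<phi>" and "(c has_vector_derivative c') (at s)"
  shows "((\<lambda>h. \<phi> (c h)) has_real_derivative frechet_derivative \<phi> (at (c s)) c') (at s)"
proof -
  have lin: "linear (frechet_derivative \<phi> (at (c s)))"
    using smooth_has_derivative[OF assms(1)] has_derivative_linear by blast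
  have "((\<lambda>h. \<phi> (c h)) has_derivative (\<lambda>h. frechet_derivative \<phi> (at (c s)) (h *\<^sub>R c'))) (at s)"
    by (rule has_derivative_compose[OF assms(2)[unfolded has_vector_derivative_def]
          smooth_has_derivative[OF assms(1)]])
  then show ?thesis
    by (simp add: linear_cmul[OF lin] has_field_derivative_def mult.commute[of _ "frechet_derivative _ _ _"])
qed

lemma integral_by_parts_compact_support:
  fixes u p \<psi> :: "'a::euclidean_space \<Rightarrow> real"
  assumes S: "open S" and u: "continuous_on S u" and p: "continuous_on S p"
    and deriv: "\<And>z. z \<in> S \<Longrightarrow> ((\<lambda>h. u (z + h *\<^sub>R e)) has_real_derivative p z) (at 0)"
    and \<psi>: "smooth \<psi>" and K: "compact K" "K \<subseteq> S" and \<psi>0: "\<And>z. z \<notin> K \<Longrightarrow> \<psi> z = 0"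
  shows "(LINT z|lborel. u z * frechet_derivative \<psi> (at z) e) = - (LINT z|lborel. p z * \<psi> z)"
proof -
  define D\<psi> where "D\<psi> = (\<lambda>z. frechet_derivative \<psi> (at z) e)"
  have D\<psi>0: "D\<psi> z = 0" if "z \<notin> K" for z
    unfolding D\<psi>_def using frechet_derivative_eq_0[of K] compact_imp_closed[OF K(1)] \<psi>0 that by blast
  have cont: "continuous_on S \<psi>" "continuous_on S D\<psi>"
    unfolding D\<psi>_def using smooth_continuous[OF \<psi>] smooth_continuous[OF smooth_frechet_derivative[OF \<psi>]]
    by (auto intro: continuous_on_subset)
  have mult: "continuous_on UNIV (\<lambda>z. a z * b z)"
    if "continuous_on S a" "continuous_on S b" "\<And>z. z \<notin> K \<Longrightarrow> b z = 0" for a b :: "'a \<Rightarrow> real"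
    by (rule continuous_on_extend_zero[OF continuous_on_mult[OF that(1,2)] S K]) (simp add: that(3))
  have ext: "continuous_on UNIV (\<lambda>z. u z * \<psi> z)" "continuous_on UNIV (\<lambda>z. u z * D\<psi> z)"
      "continuous_on UNIV (\<lambda>z. p z * \<psi> z)"
    using mult u p cont \<psi>0 D\<psi>0 by blast+
  have "(LINT z|lborel. p z * \<psi> z + u z * D\<psi> z) = 0"
  proof (rule integral_directional_derivative_eq_0[where H = "\<lambda>z. u z * \<psi> z" and K = K and e = e])
    fix z
    show "((\<lambda>h. u (z + h *\<^sub>R e) * \<psi> (z + h *\<^sub>R e)) has_real_derivative p z * \<psi> z + u z * D\<psi> z) (at 0)"
    proof (cases "z \<in> S")
      case True
      have "((\<lambda>h. z + h *\<^sub>R e) has_vector_derivative e) (at 0)"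
        by (auto intro!: derivative_eq_intros)
      from smooth_directional_derivative[OF \<psi> this]
      have "((\<lambda>h. \<psi> (z + h *\<^sub>R e)) has_real_derivative D\<psi> z) (at 0)"
        by (simp add: D\<psi>_def)
      from DERIV_mult[OF deriv[OF True] this] show ?thesis
        by (simp add: algebra_simps)
    next
      case False
      then have "z \<in> - K" using K by auto
      have "((\<lambda>h. 0) has_real_derivative 0) (at (0::real))" by simp
      then have "((\<lambda>h. u (z + h *\<^sub>R e) * \<psi> (z + h *\<^sub>R e)) has_real_derivative 0) (at 0)"
      proof (rule has_field_derivative_transform_within_open)
        show "open ((\<lambda>h. z + h *\<^sub>R e) -` (- K))"
          using K(1) by (intro open_vimage continuous_intros) (auto simp: compact_imp_closed)
      qed (use \<open>z \<in> - K\<close> \<psi>0 in auto)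
      then show ?thesis using \<open>z \<in> - K\<close> \<psi>0 D\<psi>0 by simp
    qed
  qed (use ext \<psi>0 D\<psi>0 K in \<open>auto intro!: continuous_intros\<close>)
  moreover have "integrable lborel (\<lambda>z. p z * \<psi> z)" "integrable lborel (\<lambda>z. u z * D\<psi> z)"
    using ext \<psi>0 D\<psi>0 by (auto intro: integrable_continuous_compact_support[OF _ K(1)])
  ultimately show ?thesis unfolding D\<psi>_def by simp
qed

lemma axis_expansion: "(\<Sum>i\<in>UNIV. (v $ i) *\<^sub>R axis i 1) = (v :: real^'n)"
  by (simp add: vec_eq_iff axis_def if_distrib cong: if_cong)

lemma partial_derivatives_smooth:
  fixes \<phi> :: "real \<times> (real^'n) \<times> (real^'n) \<Rightarrow> real"
  assumes \<phi>: "smooth \<phi>"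
  shows "partial_t \<phi> z = frechet_derivative \<phi> (at z) (1, 0, 0)"
    and "partial_x i \<phi> z = frechet_derivative \<phi> (at z) (0, axis i 1, 0)"
    and "partial_v i \<phi> z = frechet_derivative \<phi> (at z) (0, 0, axis i 1)"
proof -
  obtain t x v where z: "z = (t, x, v)" by (cases z)
  have "((\<lambda>s. (s, x, v)) has_vector_derivative (1, 0, 0)) (at t)"
    "((\<lambda>h. (t, x + h *\<^sub>R axis i 1, v)) has_vector_derivative (0, axis i 1, 0)) (at 0)"
    "((\<lambda>h. (t, x, v + h *\<^sub>R axis i 1)) has_vector_derivative (0, 0, axis i 1)) (at 0)"
    by (auto intro!: derivative_eq_intros has_vector_derivative_Pair simp: zero_prod_def[symmetric])
  from this[THEN smooth_directional_derivative[OF \<phi>], THEN DERIV_imp_deriv]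
  show "partial_t \<phi> z = frechet_derivative \<phi> (at z) (1, 0, 0)"
    "partial_x i \<phi> z = frechet_derivative \<phi> (at z) (0, axis i 1, 0)"
    "partial_v i \<phi> z = frechet_derivative \<phi> (at z) (0, 0, axis i 1)"
    by (simp_all add: z partial_t_def partial_x_def partial_v_def)
qed

text \<open>The differential operators of the equation as Frechet derivatives, so that the chain rule applies to
  them. The first two clauses add up to the derivative of \<open>\<phi>\<close> along \<open>(1, v, w)\<close>.\<close>

lemma kinetic_operators_smooth:
  fixes \<phi> :: "real \<times> (real^'n) \<times> (real^'n) \<Rightarrow> real"
  assumes \<phi>: "smooth \<phi>"
  shows "partial_t \<phi> (t, x, v) + transport \<phi> (t, x, v) = frechet_derivative \<phi> (at (t, x, v)) (1, v, 0)"
    and "(\<Sum>i\<in>UNIV. w $ i * partial_v i \<phi> z) = frechet_derivative \<phi> (at z) (0, 0, w)"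
    and "laplacian_v \<phi> z = (\<Sum>i\<in>UNIV. frechet_derivative (partial_v i \<phi>) (at z) (0, 0, axis i 1))"
proof -
  have lin: "linear (frechet_derivative \<phi> (at z))" for z
    using smooth_has_derivative[OF \<phi>] has_derivative_linear by blast
  have expand: "(\<Sum>i\<in>UNIV. w $ i * frechet_derivative \<phi> (at z) (F (axis i 1))) =
      frechet_derivative \<phi> (at z) (F w)" if "linear F" for w :: "real^'n" and z and F
  proof -
    have "linear (\<lambda>w. frechet_derivative \<phi> (at z) (F w))"
      using linear_compose[OF that lin] by (simp add: o_def)
    note l = this
    show ?thesis
      by (subst (2) axis_expansion[of w, symmetric])
        (simp only: linear_sum[OF l] linear_cmul[OF l] real_scaleR_def)
  qed
  have "linear (\<lambda>w::real^'n. (0::real, w, 0::real^'n))" "linear (\<lambda>w::real^'n. (0::real, 0::real^'n, w))"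
    by (auto intro!: linearI)
  note ex = this[THEN expand]
  show "(\<Sum>i\<in>UNIV. w $ i * partial_v i \<phi> z) = frechet_derivative \<phi> (at z) (0, 0, w)"
    by (simp add: partial_derivatives_smooth[OF \<phi>] ex)
  have "transport \<phi> (t, x, v) = frechet_derivative \<phi> (at (t, x, v)) (0, v, 0)"
    by (simp add: transport_def partial_derivatives_smooth[OF \<phi>] ex)
  then show "partial_t \<phi> (t, x, v) + transport \<phi> (t, x, v) = frechet_derivative \<phi> (at (t, x, v)) (1, v, 0)"
    using linear_add[OF lin, of "(t, x, v)" "(1, 0, 0)" "(0, v, 0)"]
    by (simp add: partial_derivatives_smooth[OF \<phi>])
  have "smooth (partial_v i \<phi>)" for i
    using smooth_frechet_derivative[OF \<phi>] partial_derivatives_smooth(3)[OF \<phi>]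
    by (metis (no_types, lifting) ext)
  then show "laplacian_v \<phi> z = (\<Sum>i\<in>UNIV. frechet_derivative (partial_v i \<phi>) (at z) (0, 0, axis i 1))"
    by (simp add: laplacian_v_def partial_derivatives_smooth(3))
qed

section \<open>Integrability of the profile\<close>

text \<open>The quadratic form of the profile in similarity variables; it is the energy of the harmonic
  oscillator \<open>y' = w\<close>, \<open>w' = - A *\<^sub>R y\<close>.\<close>

definition energy :: "real \<Rightarrow> 'a::real_normed_vector \<times> 'a \<Rightarrow> real" where
  "energy A z = (norm (snd z))\<^sup>2 + A * (norm (fst z))\<^sup>2"

lemma continuous_on_energy [continuous_intros]:
  "continuous_on S f \<Longrightarrow> continuous_on S (\<lambda>z. energy A (f z))"
  unfolding energy_def by (intro continuous_intros)

lemma profile_energy: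
  "profile m A \<gamma> (fst z) (snd z) =
     (max 0 ((1 - m) / m * (\<gamma> + (1 + A) / 2 * energy A z))) powr (1 / (m - 1))"
  by (simp add: profile_def energy_def algebra_simps)

lemma measurable_profile [measurable]:
  "(\<lambda>z. profile m A \<gamma> (fst z) (snd z)) \<in> borel_measurable borel"
proof -
  have "energy A \<in> borel_measurable borel" for A :: real
    using continuous_on_energy[of UNIV "\<lambda>z. z"] by (auto intro!: borel_measurable_continuous_onI)
  then show ?thesis unfolding profile_energy by measurable
qed

text \<open>Let \<open>I R\<close> be the integral over the ball of radius \<open>R\<close>. The substitution \<open>z \<mapsto> 2 *\<^sub>R z\<close> bounds
  \<open>I (2 * R)\<close> by \<open>\<theta> * I R\<close> plus a constant, where \<open>\<theta> = 2 powr (DIM - q) < 1\<close>. As \<open>I R \<le> I (2 * R)\<close>,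
  this bounds all \<open>I R\<close> by a constant.\<close>

lemma integrable_max_1_norm_powr:
  fixes q :: real
  assumes q: "DIM('a::euclidean_space) < q"
  shows "integrable lborel (\<lambda>z::'a. max 1 (norm z) powr (- q))"
proof -
  define k where "k = (\<lambda>z::'a. max 1 (norm z) powr (- q))"
  define kR where "kR = (\<lambda>R (z::'a). indicator (ball 0 R) z * k z)"
  define N where "N = DIM('a)"
  have k: "0 \<le> k z" "k z \<le> 1" for z
    using powr_mono[of "- q" 0 "max 1 (norm z)"] q by (auto simp: k_def split: if_splits)
  have k_meas: "k \<in> borel_measurable borel"
    unfolding k_def by measurable
  have ball: "integrable lborel (\<lambda>z::'a. indicator (ball 0 R) z :: real)" for R
    using emeasure_lborel_ball_finite[of "0::'a" R] by (simp add: integrable_indicator_iff)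
  have [measurable]: "kR R \<in> borel_measurable borel" for R
    unfolding kR_def by (intro borel_measurable_times borel_measurable_indicator k_meas) simp
  have kR: "integrable lborel (kR R)" for R
    by (rule Bochner_Integration.integrable_bound[OF ball[of R]], measurable)
      (use k in \<open>auto simp: kR_def indicator_def\<close>)
  define I where "I R = (LINT z|lborel. kR R z)" for R
  define V where "V = (LINT z|lborel. indicator (ball (0::'a) 1) z :: real)"
  define \<theta> where "\<theta> = 2 powr (real N - q)"
  have \<theta>: "0 < \<theta>" "\<theta> < 1" using q powr_less_mono[of "real N - q" 0 2] unfolding \<theta>_def N_def by auto
  have I_mono: "I R \<le> I R'" if "R \<le> R'" for R R'
    unfolding I_def using kR k that by (intro integral_mono) (auto simp: kR_def indicator_def)
  have rec: "I (2 * R) \<le> \<theta> * I R + 2 ^ N * V" if "0 \<le> R" for R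
  proof -
    have "I (2 * R) = 2 ^ N * (LINT z|lborel. kR (2 * R) (2 *\<^sub>R z))"
    proof -
      have "I (2 * R) = (LINT z|density (distr lborel borel (\<lambda>z. 0 + 2 *\<^sub>R z)) (\<lambda>_. ennreal (\<bar>2\<bar> ^ DIM('a))). kR (2 * R) z)"
        unfolding I_def by (subst lborel_affine[of 2 0, symmetric]) auto
      also have "\<dots> = 2 ^ N * (LINT z|lborel. kR (2 * R) (2 *\<^sub>R z))"
        by (subst integral_density) (auto simp: integral_distr N_def)
      finally show ?thesis .
    qed
    also have "\<dots> \<le> 2 ^ N * (LINT z|lborel. 2 powr (- q) * kR R z + indicator (ball 0 1) z)"
    proof (intro mult_left_mono integral_mono')
      fix z :: 'a
      show "kR (2 * R) (2 *\<^sub>R z) \<le> 2 powr (- q) * kR R z + indicator (ball 0 1) z"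
      proof (cases "norm z < 1")
        case True
        then have "indicator (ball 0 1) z = (1::real)" by simp
        moreover have "kR (2 * R) (2 *\<^sub>R z) \<le> 1" "0 \<le> 2 powr (- q) * kR R z"
          using k by (auto simp: kR_def indicator_def)
        ultimately show ?thesis by linarith
      next
        case False
        then have "k (2 *\<^sub>R z) = 2 powr (- q) * k z"
          by (auto simp: k_def powr_mult max_def)
        then show ?thesis using False by (auto simp: kR_def indicator_def)
      qed
    qed (use kR ball k in \<open>auto simp: kR_def\<close>)
    also have "\<dots> = \<theta> * I R + 2 ^ N * V"
      using kR ball by (simp add: I_def V_def \<theta>_def powr_diff powr_minus powr_realpow field_simps)
    finally show ?thesis .
  qed
  have bound: "I R \<le> 2 ^ N * V / (1 - \<theta>)" if "0 \<le> R" for R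
  proof -
    have "I (2 * R) \<le> \<theta> * I (2 * R) + 2 ^ N * V"
      using rec[OF that] I_mono[of R "2 * R"] that \<theta> by (smt (verit) mult_left_mono)
    then have "I (2 * R) \<le> 2 ^ N * V / (1 - \<theta>)"
      using \<theta> by (simp add: field_simps)
    then show ?thesis using I_mono[of R "2 * R"] that by simp
  qed
  have "integrable lborel k"
  proof (rule integrableI_bounded)
    have eq: "ennreal (norm (k z)) = (SUP n. ennreal (kR (real n) z))" for z
    proof (rule antisym)
      obtain n where "norm z < real n" using reals_Archimedean2 by blast
      then show "ennreal (norm (k z)) \<le> (SUP n. ennreal (kR (real n) z))"
        using k by (intro SUP_upper2[of n]) (auto simp: kR_def)
      show "(SUP n. ennreal (kR (real n) z)) \<le> ennreal (norm (k z))"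
        using k by (intro SUP_least ennreal_leI) (auto simp: kR_def indicator_def)
    qed
    have "(\<integral>\<^sup>+z. ennreal (norm (k z)) \<partial>lborel) = (SUP n. \<integral>\<^sup>+z. ennreal (kR (real n) z) \<partial>lborel)"
      unfolding eq
    proof (rule nn_integral_monotone_convergence_SUP)
      show "incseq (\<lambda>n z. ennreal (kR (real n) z))"
        using k by (auto simp: incseq_def le_fun_def kR_def indicator_def intro!: ennreal_leI)
    qed measurable
    also have "\<dots> = (SUP n. ennreal (I (real n)))"
      unfolding I_def using kR k by (intro SUP_cong nn_integral_eq_integral refl) (auto simp: kR_def)
    also have "\<dots> \<le> ennreal (2 ^ N * V / (1 - \<theta>))"
      using bound by (intro SUP_least ennreal_leI) auto
    also have "\<dots> < \<infinity>" by simp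
    finally show "(\<integral>\<^sup>+z. ennreal (norm (k z)) \<partial>lborel) < \<infinity>" .
  qed (simp add: k_meas)
  then show ?thesis unfolding k_def .
qed

lemma energy_block_map:
  "energy A (block_map r 0 0 s z) = s\<^sup>2 * (norm (snd z))\<^sup>2 + A * (r\<^sup>2 * (norm (fst z))\<^sup>2)"
  by (simp add: energy_def block_map_def case_prod_beta power_mult_distrib)

text \<open>For \<open>m < 1\<close> restrict the profile to the cone where its quadratic form is nonnegative: there it is a
  power with exponent at least \<open>- d\<close> of a positive constant plus a quadratic form, and \<open>4 ^ d\<close> times
  its value at \<open>2 *\<^sub>R z\<close> exceeds its value at \<open>z\<close>. For \<open>m \<ge> 1 + 1 / d\<close> one has \<open>A \<le> 0\<close>, so that the
  profile does not decrease when \<open>x\<close> alone is doubled, and that dilation has determinant \<open>2 ^ d\<close>.\<close>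

lemma not_integrable_profile:
  fixes d :: nat
  assumes d: "d = CARD('n::finite)"
    and m: "m > 0" "m \<noteq> 1" "3 - real d + real d * m \<noteq> 0"
    and A: "A = (1 + real d - real d * m) / (3 - real d + real d * m)"
    and \<gamma>: "(1 - m) * \<gamma> > 0"
    and out: "m \<notin> {1 - 1 / real d<..<1} \<union> {1<..<1 + 1 / real d}"
  shows "\<not> integrable lborel (\<lambda>z. profile m A \<gamma> (fst z) (snd z :: real^'n))"
proof
  assume int: "integrable lborel (\<lambda>z. profile m A \<gamma> (fst z) (snd z :: real^'n))"
  define D where "D = 3 - real d + real d * m"
  have d0: "real d > 0" using d by simp
  have a: "(1 + A) / 2 = 2 / D"
    using m(3) unfolding A D_def by (simp add: field_simps)
  have aA: "(1 + A) / 2 * A = 2 * (1 + real d * (1 - m)) / D\<^sup>2"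
    unfolding a unfolding A D_def by (simp add: power2_eq_square algebra_simps)
  have D0: "D \<noteq> 0" using m D_def by simp
  show False
  proof (cases "m < 1")
    case True
    define c where "c = (1 - m) / m"
    define p where "p = 1 / (1 - m)"
    define Q where "Q = (\<lambda>z::(real^'n) \<times> (real^'n). (1 + A) / 2 * energy A z)"
    have g: "\<gamma> > 0" using True \<gamma> by (simp add: zero_less_mult_iff)
    have c: "c > 0" and p: "p > 0" "- p = 1 / (m - 1)"
      using True m by (auto simp: c_def p_def field_simps)
    \<comment> \<open>This is \<open>m \<le> 1 - 1 / d\<close>.\<close>
    have pd: "p \<le> d"
      using True out d0 m by (auto simp: p_def field_simps)
    have prof: "profile m A \<gamma> (fst z) (snd z) = (c * (\<gamma> + Q z)) powr (- p)" if "0 \<le> Q z" for z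
    proof -
      have "profile m A \<gamma> (fst z) (snd z) = max 0 (c * (\<gamma> + Q z)) powr (- p)"
        unfolding profile_energy p(2) Q_def c_def ..
      then show ?thesis using that c g by simp
    qed
    have Qcont: "continuous_on S Q" for S
      unfolding Q_def by (intro continuous_intros)
    define h where "h = (\<lambda>z. indicator {z. 0 \<le> Q z} z * profile m A \<gamma> (fst z) (snd z))"
    have clos: "closed {z. 0 \<le> Q z}" and opn: "open {z. 0 < Q z}"
      by (auto intro!: closed_Collect_le open_Collect_less Qcont continuous_intros)
    have meas: "h \<in> borel_measurable borel"
      unfolding h_def
      by (intro borel_measurable_times borel_measurable_indicator measurable_profile borel_closed clos)
    have Q2: "Q (block_map 2 0 0 2 z) = 4 * Q z" for z
      unfolding Q_def energy_block_map by (simp add: energy_def algebra_simps)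
    have less: "h z < \<bar>2 * 2 - 0 * 0\<bar> ^ DIM(real^'n) * h (block_map 2 0 0 2 z)" if "0 \<le> Q z" for z
    proof -
      have "h z = (c * (\<gamma> + Q z)) powr (- p)" using that by (simp add: h_def prof)
      also have "\<dots> < (c * (\<gamma> / 4 + Q z)) powr (- p)"
        using c g p(1) that by (intro powr_less_mono2_neg mult_strict_left_mono mult_pos_pos) auto
      also have "c * (\<gamma> / 4 + Q z) = c * (\<gamma> + 4 * Q z) / 4"
        by (simp add: field_simps)
      also have "(c * (\<gamma> + 4 * Q z) / 4) powr (- p) = 4 powr p * (c * (\<gamma> + 4 * Q z)) powr (- p)"
        using c g that by (subst powr_divide) (auto simp: powr_minus field_simps)
      also have "\<dots> \<le> 4 ^ d * (c * (\<gamma> + 4 * Q z)) powr (- p)"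
        using powr_mono[OF pd, of 4] by (intro mult_right_mono) (auto simp: powr_realpow)
      finally show ?thesis using that by (simp add: h_def prof Q2 d)
    qed
    have "\<not> integrable lborel h"
    proof (rule not_integrable_if_superscaling[of h 2 2 0 0 "{z. 0 < Q z}"])
      fix z show "h z \<le> \<bar>2 * 2 - 0 * 0\<bar> ^ DIM(real^'n) * h (block_map 2 0 0 2 z)"
        using less[of z] by (cases "0 \<le> Q z") (auto simp: h_def Q2)
    next
      have "(axis undefined 1, 0) \<in> {z. 0 < Q z}"
      proof -
        \<comment> \<open>When \<open>m\<close> is so small that \<open>D < 0\<close>, both \<open>1 + A\<close> and \<open>A\<close> are negative: the form is indefinite but positive in the direction of \<open>x\<close>.\<close>
        have "0 < (1 + A) / 2 * A"
          unfolding aA using True D0 by (simp add: add_pos_nonneg)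
        then show ?thesis unfolding Q_def by (simp add: energy_def)
      qed
      then show "{z. 0 < Q z} \<noteq> {}" by blast
    qed (use less opn meas in auto)
    moreover have "integrable lborel h"
      using integrable_mult_indicator[OF _ int, of "{z. 0 \<le> Q z}"] clos by (simp add: h_def)
    ultimately show False by blast
  next
    case False
    then have m1: "m > 1" using m by simp
    have D: "D > 0" unfolding D_def using m1 d0 by (smt (verit) mult_less_cancel_left2)
    have a0: "0 < (1 + A) / 2" unfolding a using D by simp
    have "real d * (1 - m) \<le> -1" using out m1 d0 by (auto simp: field_simps)
    then have aA0: "(1 + A) / 2 * A \<le> 0"
      unfolding aA using D by (intro divide_nonpos_pos) auto
    define c where "c = (1 - m) / m"
    have c: "c < 0" using m1 by (simp add: c_def divide_neg_pos)
    have cg: "c * \<gamma> > 0"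
      using \<gamma> m unfolding c_def by (metis divide_pos_pos times_divide_eq_left)
    define h where "h = (\<lambda>z. profile m A \<gamma> (fst z) (snd z :: real^'n))"
    define B where "B = (\<lambda>z :: (real^'n) \<times> (real^'n). c * (\<gamma> + (1 + A) / 2 * energy A z))"
    have h_eq: "h z = max 0 (B z) powr (1 / (m - 1))" for z
      unfolding h_def profile_energy B_def c_def ..
    have mono: "h z \<le> h (block_map 2 0 0 1 z)" for z
    proof -
      have "(1 + A) / 2 * energy A (block_map 2 0 0 1 z) =
          (1 + A) / 2 * energy A z + 3 * ((1 + A) / 2 * A) * (norm (fst z))\<^sup>2"
        unfolding energy_block_map by (simp add: energy_def field_simps)
      also have "\<dots> \<le> (1 + A) / 2 * energy A z"
      proof -
        have "3 * ((1 + A) / 2 * A) \<le> 0" using aA0 by linarith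
        then show ?thesis by (simp only: add_le_same_cancel1 mult_nonpos_nonneg zero_le_power2)
      qed
      finally have "B z \<le> B (block_map 2 0 0 1 z)"
        unfolding B_def using c by (intro mult_left_mono_neg) auto
      then show ?thesis unfolding h_eq using m1 by (intro powr_mono2) auto
    qed
    have two: "h (block_map 2 0 0 1 z) * 2 \<le> \<bar>2 * 1 - 0 * 0\<bar> ^ DIM(real^'n) * h (block_map 2 0 0 1 z)" for z
    proof -
      have "(2::real) ^ 1 \<le> 2 ^ d" using d0 by (intro power_increasing) auto
      then have "2 * h (block_map 2 0 0 1 z) \<le> 2 ^ d * h (block_map 2 0 0 1 z)"
        by (intro mult_right_mono) (auto simp: h_eq)
      then show ?thesis by (simp add: d mult.commute)
    qed
    have "\<not> integrable lborel h"
    proof (rule not_integrable_if_superscaling[of h 2 1 0 0 "{z. 0 < B z}"])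
      fix z
      show "h z \<le> \<bar>2 * 1 - 0 * 0\<bar> ^ DIM(real^'n) * h (block_map 2 0 0 1 z)"
        using mono[of z] two[of z] by (smt (verit) h_eq powr_ge_zero)
      assume "z \<in> {z. 0 < B z}"
      then have "0 < h z" by (simp add: h_eq)
      then show "h z < \<bar>2 * 1 - 0 * 0\<bar> ^ DIM(real^'n) * h (block_map 2 0 0 1 z)"
        using mono[of z] two[of z] by linarith
    next
      show "open {z. 0 < B z}"
        unfolding B_def by (intro open_Collect_less continuous_intros)
      have "0 \<in> {z. 0 < B z}" using cg by (simp add: B_def energy_def)
      then show "{z. 0 < B z} \<noteq> {}" by blast
    qed (auto simp: h_def)
    then show False using int by (simp add: h_def)
  qed
qed


text \<open>All of them follow from \<open>\<bar>d * (1 - m)\<bar> < 1\<close>. The equation relates the scaling of \<open>f powr m\<close> to that of \<open>f\<close>.\<close>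

lemma exponent_bounds:
  assumes d: "0 < d" and m: "m > 0" "m \<in> {1 - 1 / real d<..<1} \<union> {1<..<1 + 1 / real d}"
    and A: "A = (1 + real d - real d * m) / (3 - real d + real d * m)"
  shows "0 < A" "A < 1" "(1 + A) * (1 - m) * real d = 3 * A - 1" "real d * (1 - m) < 1"
    "real d + 1 / (m - 1) \<noteq> 0"
proof -
  have \<delta>: "-1 < real d * (1 - m)" "real d * (1 - m) < 1"
  proof -
    have "0 < real d * (1 - m)" if "m < 1" using that d by simp
    moreover have "real d * (1 - m) < 0" if "1 < m" using that d by (simp add: mult_pos_neg)
    moreover have "real d * (1 - m) < 1" if "1 - 1 / real d < m" using that d by (simp add: field_simps)
    moreover have "-1 < real d * (1 - m)" if "m < 1 + 1 / real d" using that d by (simp add: field_simps)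
    ultimately show "-1 < real d * (1 - m)" "real d * (1 - m) < 1" using m(2) by fastforce+
  qed
  then show "real d * (1 - m) < 1" by simp
  have D: "0 < 3 - real d + real d * m" and N: "0 < 1 + real d - real d * m"
    using \<delta> by (auto simp: algebra_simps)
  show "0 < A" unfolding A using D N by simp
  show "A < 1" unfolding A using D \<delta> by (simp add: algebra_simps)
  show "(1 + A) * (1 - m) * real d = 3 * A - 1"
    unfolding A using D by (simp add: field_simps)
  have m1: "m < 1 \<or> 1 < m" using m(2) by auto
  show "real d + 1 / (m - 1) \<noteq> 0"
    using \<delta> m1 d by (auto simp: field_simps)
qed

text \<open>The alternative behind the continuity of the profile and the differentiability of its power:
  either the positive part is not active or it is raised to a positive power.\<close>

lemma profile_base_pos_or_exponent_pos:
  assumes "0 < m" "m \<noteq> 1" "0 \<le> A" "(1 - m) * \<gamma> > 0"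
  shows "0 < (1 - m) / m * (\<gamma> + (1 + A) / 2 * energy A z) \<or> 0 < 1 / (m - 1)"
proof (cases "m < 1")
  case True
  then have "0 < \<gamma>" using assms by (simp add: zero_less_mult_iff)
  then show ?thesis using True assms
    by (intro disjI1 mult_pos_pos add_pos_nonneg) (auto simp: energy_def)
qed (use assms in auto)

lemma continuous_profile:
  assumes "0 < m" "m \<noteq> 1" "0 \<le> A" "(1 - m) * \<gamma> > 0"
  shows "continuous_on S (\<lambda>z. profile m A \<gamma> (fst z) (snd z :: real^'n))"
proof -
  define B where "B z = (1 - m) / m * (\<gamma> + (1 + A) / 2 * energy A z)" for z :: "(real^'n) \<times> (real^'n)"
  have "continuous_on S B"
    unfolding B_def by (intro continuous_intros)
  moreover have "0 < B z \<or> 0 < 1 / (m - 1)" for z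
    unfolding B_def by (rule profile_base_pos_or_exponent_pos[OF assms])
  then have "\<forall>z\<in>S. 0 \<le> max 0 (B z) \<and> (max 0 (B z) = 0 \<longrightarrow> 0 < 1 / (m - 1))"
    by (metis max.cobounded1 max_absorb2 less_imp_le less_irrefl)
  ultimately show ?thesis
    unfolding profile_energy B_def[symmetric]
    by (intro continuous_on_powr' continuous_intros)
qed

lemma norm_power2_prod: "(norm z)\<^sup>2 = (norm (fst z))\<^sup>2 + (norm (snd z))\<^sup>2"
  by (simp add: norm_prod_def)

text \<open>For \<open>m < 1\<close> the profile is at most a multiple of \<open>norm z powr (- 2 / (1 - m))\<close> at infinity, which
  is integrable in dimension \<open>2 * d\<close> as \<open>d * (1 - m) < 1\<close>. For \<open>m > 1\<close> it is continuous with
  compact support.\<close>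

lemma integrable_profile:
  assumes m: "0 < m" "m \<noteq> 1" "real CARD('n::finite) * (1 - m) < 1" and A: "0 < A"
    and \<gamma>: "(1 - m) * \<gamma> > 0"
  shows "integrable lborel (\<lambda>z. profile m A \<gamma> (fst z) (snd z :: real^'n))"
proof -
  define a where "a = (1 + A) / 2"
  define \<kappa> where "\<kappa> = a * min 1 A"
  have a: "0 < a" and \<kappa>: "0 < \<kappa>" using A by (auto simp: a_def \<kappa>_def)
  have coercive: "\<kappa> * (norm z)\<^sup>2 \<le> a * energy A z" for z :: "(real^'n) \<times> (real^'n)"
  proof -
    have "min 1 A * (norm z)\<^sup>2 \<le> energy A z"
      unfolding norm_power2_prod energy_def using A
      by (simp add: distrib_left add.commute) (smt (verit) mult_left_le_one_le mult_right_mono zero_le_power2 mult_right_le_one_le min_def)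
    then show ?thesis unfolding \<kappa>_def using a by simp
  qed
  note cont = continuous_profile[OF m(1,2) less_imp_le[OF A] \<gamma>]
  show ?thesis
  proof (cases "m < 1")
    case True
    define c where "c = (1 - m) / m"
    define p where "p = 1 / (1 - m)"
    define \<mu> where "\<mu> = min \<gamma> \<kappa>"
    have g: "0 < \<gamma>" using True \<gamma> by (simp add: zero_less_mult_iff)
    have c: "0 < c" and p: "0 < p" "- p = 1 / (m - 1)" and \<mu>: "0 < \<mu>"
      using True m g \<kappa> by (auto simp: c_def p_def \<mu>_def field_simps)
    have "DIM((real^'n) \<times> (real^'n)) < 2 * p"
      using m(3) True by (simp add: p_def field_simps)
    then have "integrable lborel (\<lambda>z::(real^'n) \<times> (real^'n). (c * \<mu>) powr (- p) * max 1 (norm z) powr (- (2 * p)))"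
      using integrable_max_1_norm_powr by (intro integrable_mult_right) blast
    then show ?thesis
    proof (rule Bochner_Integration.integrable_bound)
      show "AE z in lborel. norm (profile m A \<gamma> (fst z) (snd z :: real^'n)) \<le>
          norm ((c * \<mu>) powr (- p) * max 1 (norm z) powr (- (2 * p)))"
      proof (rule AE_I2)
        fix z :: "(real^'n) \<times> (real^'n)"
        have "\<mu> * (max 1 (norm z))\<^sup>2 \<le> \<mu> * (1 + (norm z)\<^sup>2)"
          using \<mu> by (intro mult_left_mono) (auto simp: max_def)
        also have "\<dots> \<le> \<gamma> + \<kappa> * (norm z)\<^sup>2"
          unfolding distrib_left by (intro add_mono mult_right_mono) (auto simp: \<mu>_def)
        also have "\<dots> \<le> \<gamma> + a * energy A z" using coercive[of z] by simp
        finally have le: "c * (\<mu> * (max 1 (norm z))\<^sup>2) \<le> c * (\<gamma> + a * energy A z)"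
          using c by simp
        have pos: "0 < c * (\<mu> * (max 1 (norm z))\<^sup>2)" using c \<mu> by auto
        have "profile m A \<gamma> (fst z) (snd z) = (c * (\<gamma> + a * energy A z)) powr (- p)"
        proof -
          have "profile m A \<gamma> (fst z) (snd z) = max 0 (c * (\<gamma> + a * energy A z)) powr (- p)"
            unfolding profile_energy p(2) a_def c_def ..
          then show ?thesis using le pos by (simp add: max_absorb2)
        qed
        also have "\<dots> \<le> (c * (\<mu> * (max 1 (norm z))\<^sup>2)) powr (- p)"
          using le pos p(1) by (intro powr_mono2') auto
        also have "\<dots> = (c * \<mu>) powr (- p) * max 1 (norm z) powr (- (2 * p))"
        proof -
          have "((max 1 (norm z))\<^sup>2) powr (- p) = max 1 (norm z) powr (- (2 * p))"
          proof -
            have "(max 1 (norm z))\<^sup>2 = max 1 (norm z) powr 2" by simp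
            then show ?thesis by (simp only: powr_powr mult_minus_right)
          qed
          then show ?thesis using c \<mu> by (simp add: powr_mult mult.assoc)
        qed
        finally show "norm (profile m A \<gamma> (fst z) (snd z :: real^'n)) \<le>
          norm ((c * \<mu>) powr (- p) * max 1 (norm z) powr (- (2 * p)))"
          by (simp add: profile_def)
      qed
    qed simp
  next
    case False
    then have m1: "1 < m" using m by simp
    have g: "\<gamma> < 0" using m1 \<gamma> by (simp add: zero_less_mult_iff)
    show ?thesis
    proof (rule integrable_continuous_compact_support[OF cont compact_cball])
      fix z :: "(real^'n) \<times> (real^'n)"
      assume "z \<notin> cball 0 (sqrt (- \<gamma> / \<kappa>))"
      then have "sqrt (- \<gamma> / \<kappa>) < norm z" by simp
      then have "- \<gamma> / \<kappa> < (norm z)\<^sup>2"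
        by (meson norm_ge_zero not_less real_le_rsqrt real_sqrt_le_iff sqrt_le_D)
      then have "- \<gamma> < \<kappa> * (norm z)\<^sup>2" using \<kappa> by (simp add: field_simps)
      then have "0 < \<gamma> + a * energy A z" using coercive[of z] by linarith
      moreover have "(1 - m) / m < 0" using m1 by (simp add: divide_neg_pos)
      ultimately have "(1 - m) / m * (\<gamma> + a * energy A z) < 0"
        by (rule mult_neg_pos[rotated])
      then show "profile m A \<gamma> (fst z) (snd z) = 0"
        unfolding profile_energy a_def[symmetric] by simp
    qed
  qed
qed

lemma profile_scaling:
  assumes "0 < r"
  shows "profile m A (r\<^sup>2 * \<gamma>) (r *\<^sub>R x) (r *\<^sub>R v) = r powr (2 / (m - 1)) * profile m A \<gamma> x v"
proof -
  define B where "B = (1 - m) / m * (\<gamma> + (1 + A) / 2 * (norm v)\<^sup>2 + (1 + A) / 2 * A * (norm x)\<^sup>2)"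
  have "profile m A (r\<^sup>2 * \<gamma>) (r *\<^sub>R x) (r *\<^sub>R v) = max 0 (r\<^sup>2 * B) powr (1 / (m - 1))"
    by (simp add: profile_def B_def power_mult_distrib algebra_simps)
  also have "max 0 (r\<^sup>2 * B) = r powr 2 * max 0 B"
    using assms by (auto simp: max_def zero_le_mult_iff)
  also have "\<dots> powr (1 / (m - 1)) = r powr (2 / (m - 1)) * profile m A \<gamma> x v"
    by (simp add: powr_mult powr_powr profile_def B_def)
  finally show ?thesis .
qed

lemma mass_scaling:
  assumes "0 < r"
  shows "(LINT z|lborel. profile m A (r\<^sup>2 * \<gamma>) (fst z) (snd z :: real^'n)) =
    r powr (2 * (real CARD('n) + 1 / (m - 1))) * (LINT z|lborel. profile m A \<gamma> (fst z) (snd z :: real^'n))"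
proof -
  have "(LINT z|lborel. profile m A (r\<^sup>2 * \<gamma>) (fst z) (snd z :: real^'n)) =
      \<bar>r * r - 0 * 0\<bar> ^ DIM(real^'n) * (LINT z|lborel. profile m A (r\<^sup>2 * \<gamma>)
        (fst (block_map r 0 0 r z)) (snd (block_map r 0 0 r z) :: real^'n))"
    using assms by (subst integral_block_map(2)) auto
  also have "\<dots> = (r * r) ^ CARD('n) * r powr (2 / (m - 1)) * (LINT z|lborel. profile m A \<gamma> (fst z) (snd z :: real^'n))"
    using assms by (simp add: block_map_def case_prod_beta profile_scaling)
  also have "(r * r) ^ CARD('n) = r powr (2 * real CARD('n))"
    using assms powr_realpow[OF assms, of "2 * CARD('n)"] by (simp add: power_mult power2_eq_square)
  finally show ?thesis
    using assms by (simp add: powr_add[symmetric] distrib_left)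
qed

lemma mass_positive:
  assumes "0 < m" "m \<noteq> 1" "0 \<le> A" "(1 - m) * \<gamma> > 0"
    and int: "integrable lborel (\<lambda>z. profile m A \<gamma> (fst z) (snd z :: real^'n))"
  shows "0 < (LINT z|lborel. profile m A \<gamma> (fst z) (snd z :: real^'n))"
proof (rule integral_pos_if_pos_on_open[OF int])
  let ?U = "{z. 0 < profile m A \<gamma> (fst z) (snd z :: real^'n)}"
  show "open ?U"
    using continuous_profile[OF assms(1-4)] by (intro open_Collect_less) auto
  have pos: "0 < (1 - m) / m * \<gamma>"
    using assms by (metis divide_pos_pos times_divide_eq_left)
  then have "0 < max 0 ((1 - m) / m * \<gamma>) powr (1 / (m - 1))"
    unfolding max_absorb2[OF less_imp_le[OF pos]] powr_gt_zero by (metis less_irrefl)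
  moreover have "profile m A \<gamma> 0 (0 :: real^'n) = max 0 ((1 - m) / m * \<gamma>) powr (1 / (m - 1))"
    by (simp add: profile_def)
  ultimately have "0 \<in> ?U" by (simp only: mem_Collect_eq fst_zero snd_zero)
  then show "?U \<noteq> {}" by blast
qed (auto simp: profile_def)

text \<open>The admissible \<open>\<gamma>\<close> are the numbers \<open>r ^ 2 * (1 - m)\<close> with \<open>r > 0\<close>, and the mass is a positive
  constant times a nonzero power of \<open>r\<close>.\<close>

lemma exists_unique_unit_mass:
  assumes m: "0 < m" "m \<noteq> 1" "real CARD('n::finite) * (1 - m) < 1" "real CARD('n) + 1 / (m - 1) \<noteq> 0"
    and A: "0 < A"
  shows "\<exists>!\<gamma>. (1 - m) * \<gamma> > 0 \<and> (LINT z|lborel. profile m A \<gamma> (fst z) (snd z :: real^'n)) = 1"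
proof -
  define M where "M \<gamma> = (LINT z|lborel. profile m A \<gamma> (fst z) (snd z :: real^'n))" for \<gamma>
  define q where "q = 2 * (real CARD('n) + 1 / (m - 1))"
  have q: "q \<noteq> 0" using m(4) unfolding q_def by simp
  have scaling: "M (r\<^sup>2 * \<gamma>) = r powr q * M \<gamma>" if "0 < r" for r \<gamma>
    unfolding M_def q_def using mass_scaling[OF that] .
  have pos: "0 < (1 - m) * (1 - m)" using m by (auto simp: zero_less_mult_iff)
  have M: "0 < M (1 - m)"
    unfolding M_def
    by (rule mass_positive[OF m(1,2) less_imp_le[OF A] pos integrable_profile[OF m(1-3) A pos]])
  have ex: "\<exists>r>0. \<gamma> = r\<^sup>2 * (1 - m)" if "(1 - m) * \<gamma> > 0" for \<gamma>
  proof -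
    have "0 < \<gamma> / (1 - m)" using that by (auto simp: zero_less_mult_iff zero_less_divide_iff)
    then show ?thesis using m(2) by (intro exI[of _ "sqrt (\<gamma> / (1 - m))"]) simp
  qed
  define r where "r = M (1 - m) powr (- 1 / q)"
  have r: "0 < r" "r powr q * M (1 - m) = 1"
  proof -
    show "0 < r" using M by (simp add: r_def)
    have "r powr q = M (1 - m) powr (- 1)"
      unfolding r_def powr_powr using q by simp
    then show "r powr q * M (1 - m) = 1" using M by (simp add: powr_minus)
  qed
  show ?thesis
  proof (rule ex1I[of _ "r\<^sup>2 * (1 - m)"])
    show "0 < (1 - m) * (r\<^sup>2 * (1 - m)) \<and>
        (LINT z|lborel. profile m A (r\<^sup>2 * (1 - m)) (fst z) (snd z :: real^'n)) = 1"
      using r scaling[OF r(1), of "1 - m"] pos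
      by (simp add: M_def[symmetric] mult.left_commute[of _ "r\<^sup>2"])
    fix \<gamma>
    assume \<gamma>: "0 < (1 - m) * \<gamma> \<and> (LINT z|lborel. profile m A \<gamma> (fst z) (snd z :: real^'n)) = 1"
    then obtain s where s: "0 < s" "\<gamma> = s\<^sup>2 * (1 - m)" using ex by blast
    have "s powr q * M (1 - m) = r powr q * M (1 - m)"
      using \<gamma> scaling[OF s(1), of "1 - m"] r(2) by (simp add: M_def s(2))
    then have "s powr q = r powr q" using M by simp
    then have "s = r" using s(1) r(1) q by (metis ln_powr mult_cancel_left ln_inj_iff)
    then show "\<gamma> = r\<^sup>2 * (1 - m)" using s by simp
  qed
qed

section \<open>The characteristic flow\<close>

text \<open>The two fundamental solutions of the harmonic oscillator \<open>y' = w\<close>, \<open>w' = - A *\<^sub>R y\<close> at time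
  \<open>ln (scale A t)\<close>.\<close>

definition rot_cos :: "real \<Rightarrow> real \<Rightarrow> real" where
  "rot_cos A t = cos (sqrt A * ln (scale A t))"

definition rot_sin :: "real \<Rightarrow> real \<Rightarrow> real" where
  "rot_sin A t = sin (sqrt A * ln (scale A t)) / sqrt A"

text \<open>The solution of the oscillator with value \<open>z\<close> at the time when \<open>R = 1\<close>, written in the original variables by
  \<open>x = R *\<^sub>R y\<close> and \<open>v = R powr A *\<^sub>R (w + y)\<close>, where \<open>R = scale A t\<close>.\<close>

definition flow :: "real \<Rightarrow> real \<Rightarrow> 'a \<times> 'a \<Rightarrow> 'a \<times> 'a::real_vector" where
  "flow A t = block_map
     (scale A t * rot_cos A t) (scale A t * rot_sin A t)
     (scale A t powr A * (rot_cos A t - A * rot_sin A t)) (scale A t powr A * (rot_cos A t + rot_sin A t))"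

text \<open>The similarity variable \<open>w\<close>.\<close>

definition rel_velocity :: "real \<Rightarrow> real \<Rightarrow> 'a \<Rightarrow> 'a \<Rightarrow> 'a::real_vector" where
  "rel_velocity A t x v = v /\<^sub>R (scale A t powr A) - x /\<^sub>R scale A t"

text \<open>Minus the \<open>v\<close>-gradient of \<open>f powr m\<close> divided by \<open>f\<close>, for the self-similar \<open>f\<close>; the characteristics
  move under this force.\<close>

definition acceleration :: "real \<Rightarrow> real \<Rightarrow> 'a \<Rightarrow> 'a \<Rightarrow> 'a::real_vector" where
  "acceleration A t x v = ((1 + A) * scale A t powr (2 * A - 1)) *\<^sub>R rel_velocity A t x v"

lemma scale_pos: "A < 1 \<Longrightarrow> 0 < t \<Longrightarrow> 0 < scale A t"
  by (simp add: scale_def)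

lemma scale_deriv:
  assumes "A < 1" "0 < t"
  shows "(scale A has_real_derivative scale A t powr A) (at t)"
proof -
  have pos: "0 < (1 - A) * t" using assms by simp
  have "((\<lambda>t. ((1 - A) * t) powr (1 / (1 - A))) has_real_derivative
      ((1 - A) * t) powr (1 / (1 - A) - 1) * (1 / (1 - A) * (1 - A))) (at t)"
    using pos by (auto intro!: derivative_eq_intros simp: powr_diff)
  moreover have "1 / (1 - A) - 1 = 1 / (1 - A) * A" using assms by (simp add: field_simps)
  ultimately show ?thesis
    using assms by (simp add: scale_def[abs_def] powr_powr)
qed

lemma rot_deriv:
  assumes A: "0 < A" "A < 1" and t: "0 < t"
  shows "(rot_cos A has_real_derivative - A * rot_sin A t * scale A t powr (A - 1)) (at t)"
    and "(rot_sin A has_real_derivative rot_cos A t * scale A t powr (A - 1)) (at t)"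
proof -
  note R = scale_pos[OF A(2) t]
  have ln: "((\<lambda>t. sqrt A * ln (scale A t)) has_real_derivative sqrt A * scale A t powr (A - 1)) (at t)"
    using R by (auto intro!: derivative_eq_intros scale_deriv[OF A(2) t] simp: powr_diff)
  have sq: "sqrt A * sqrt A = A" "sqrt A \<noteq> 0" using A by auto
  have AA: "A / sqrt A = sqrt A" using A by (simp add: real_div_sqrt)
  show "(rot_cos A has_real_derivative - A * rot_sin A t * scale A t powr (A - 1)) (at t)"
  proof -
    have eq: "- A * (s / sqrt A) * p = - s * (sqrt A * p)" for s p
    proof -
      have "- A * (s / sqrt A) * p = - s * (A / sqrt A * p)"
        by (simp only: divide_inverse mult_minus_left mult_minus_right mult_ac)
      then show ?thesis unfolding AA .
    qed
    show ?thesis unfolding rot_cos_def[abs_def] rot_sin_def eq using DERIV_fun_cos[OF ln] .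
  qed
  show "(rot_sin A has_real_derivative rot_cos A t * scale A t powr (A - 1)) (at t)"
    unfolding rot_sin_def[abs_def] rot_cos_def
    using DERIV_cdivide[OF DERIV_fun_sin[OF ln], of "sqrt A"] sq by (simp add: field_simps)
qed

lemma rot_identity: "0 < A \<Longrightarrow> (rot_cos A t)\<^sup>2 + A * (rot_sin A t)\<^sup>2 = 1"
  by (simp add: rot_cos_def rot_sin_def power_divide)

lemma flow_in_similarity_variables:
  assumes A: "A < 1" and t: "0 < t"
  shows "fst (flow A t z) /\<^sub>R scale A t = rot_cos A t *\<^sub>R fst z + rot_sin A t *\<^sub>R snd z"
    and "rel_velocity A t (fst (flow A t z)) (snd (flow A t z)) =
           - (A * rot_sin A t) *\<^sub>R fst z + rot_cos A t *\<^sub>R snd z"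
proof -
  have cancel: "scale A t * (r * inverse (scale A t)) = r" "inverse (scale A t) * (scale A t * r) = r"
      "inverse (scale A t powr A) * (scale A t powr A * r) = r" for r
    using scale_pos[OF A t] by simp_all
  show "fst (flow A t z) /\<^sub>R scale A t = rot_cos A t *\<^sub>R fst z + rot_sin A t *\<^sub>R snd z"
    by (simp add: flow_def block_map_def case_prod_beta scaleR_add_right cancel)
  show "rel_velocity A t (fst (flow A t z)) (snd (flow A t z)) =
      - (A * rot_sin A t) *\<^sub>R fst z + rot_cos A t *\<^sub>R snd z"
    by (simp add: flow_def block_map_def rel_velocity_def case_prod_beta scaleR_add_right cancel)
      (simp add: algebra_simps)
qed

text \<open>In the variables \<open>x\<close> and \<open>v\<close> the oscillator becomes Newton's equation \<open>x' = v\<close>,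
  \<open>v' = acceleration\<close>. The velocity is exactly \<open>v\<close> because \<open>R' = R powr A\<close>.\<close>

lemma flow_solves:
  fixes z :: "'a::real_normed_vector \<times> 'a"
  assumes A: "0 < A" "A < 1" and t: "0 < t"
  shows "((\<lambda>t. flow A t z) has_vector_derivative
           (snd (flow A t z), acceleration A t (fst (flow A t z)) (snd (flow A t z)))) (at t)"
proof -
  define R where "R = scale A t"
  define C where "C = rot_cos A t"
  define S where "S = rot_sin A t"
  have R: "0 < R" unfolding R_def using scale_pos[OF A(2) t] .
  note d = scale_deriv[OF A(2) t] rot_deriv[OF A t]
  have Rp: "R * R powr (A - 1) = R powr A" "R powr A * R powr (A - 1) = R powr (2 * A - 1)"
    "R powr A * (A * R powr (A - 1)) = A * R powr (2 * A - 1)"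
    using R by (auto simp: powr_diff powr_add[symmetric] field_simps)
  have dp: "((\<lambda>t. scale A t powr A) has_real_derivative A * R powr (2 * A - 1)) (at t)"
    using R Rp by (auto intro!: derivative_eq_intros d simp: R_def powr_diff field_simps)
  have a: "((\<lambda>t. scale A t * rot_cos A t) has_real_derivative R powr A * (C - A * S)) (at t)"
    by (rule derivative_eq_intros d refl)+
      (use Rp in \<open>simp add: R_def[symmetric] C_def[symmetric] S_def[symmetric] algebra_simps\<close>)
  have b: "((\<lambda>t. scale A t * rot_sin A t) has_real_derivative R powr A * (C + S)) (at t)"
    by (rule derivative_eq_intros d refl)+
      (use Rp in \<open>simp add: R_def[symmetric] C_def[symmetric] S_def[symmetric] algebra_simps\<close>)
  have c: "((\<lambda>t. scale A t powr A * (rot_cos A t - A * rot_sin A t)) has_real_derivative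
      (1 + A) * R powr (2 * A - 1) * - (A * S)) (at t)"
    by (rule derivative_eq_intros d dp refl)+
      (use Rp in \<open>simp add: R_def[symmetric] C_def[symmetric] S_def[symmetric] algebra_simps\<close>)
  have e: "((\<lambda>t. scale A t powr A * (rot_cos A t + rot_sin A t)) has_real_derivative
      (1 + A) * R powr (2 * A - 1) * C) (at t)"
    by (rule derivative_eq_intros d dp refl)+
      (use Rp in \<open>simp add: R_def[symmetric] C_def[symmetric] S_def[symmetric] algebra_simps\<close>)
  note vd = a b c e
  have comb: "((\<lambda>t. f t *\<^sub>R x + g t *\<^sub>R y) has_vector_derivative f' *\<^sub>R x + g' *\<^sub>R y) (at t)"
    if "(f has_real_derivative f') (at t)" "(g has_real_derivative g') (at t)" for f g f' g' and x y :: 'a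
    using that by (auto intro!: derivative_eq_intros)
  have acc: "acceleration A t (fst (flow A t z)) (snd (flow A t z)) =
      ((1 + A) * R powr (2 * A - 1) * - (A * S)) *\<^sub>R fst z + ((1 + A) * R powr (2 * A - 1) * C) *\<^sub>R snd z"
    unfolding acceleration_def flow_in_similarity_variables(2)[OF A(2) t]
    by (simp add: R_def C_def S_def scaleR_add_right scaleR_diff_right)
  show ?thesis
    unfolding acc
    using has_vector_derivative_Pair[OF comb[OF a b, of "fst z" "snd z"] comb[OF c e, of "fst z" "snd z"]]
    by (simp add: flow_def block_map_def case_prod_beta R_def C_def S_def)
qed

lemma energy_flow:
  fixes z :: "'a::real_inner \<times> 'a"
  assumes A: "0 < A" "A < 1" and t: "0 < t"
  shows "energy A (fst (flow A t z) /\<^sub>R scale A t, rel_velocity A t (fst (flow A t z)) (snd (flow A t z))) = energy A z"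
proof -
  define C where "C = rot_cos A t"
  define S where "S = rot_sin A t"
  have "energy A (fst (flow A t z) /\<^sub>R scale A t, rel_velocity A t (fst (flow A t z)) (snd (flow A t z))) =
      (C\<^sup>2 + A * S\<^sup>2) * energy A z"
    unfolding flow_in_similarity_variables[OF A(2) t] energy_def C_def[symmetric] S_def[symmetric]
    by (simp add: power2_norm_eq_inner inner_simps inner_commute[of "snd z" "fst z"])
      (simp add: algebra_simps power2_eq_square)
  then show ?thesis using rot_identity[OF A(1), of t] by (simp add: C_def S_def)
qed

text \<open>The oscillator preserves \<open>energy\<close>, and the profile depends on its arguments only through \<open>energy\<close>.\<close>

lemma self_similar_flow:
  fixes z :: "(real^'n) \<times> (real^'n)"
  assumes A: "0 < A" "A < 1" and t: "0 < t"
  shows "self_similar m A \<gamma> t (fst (flow A t z)) (snd (flow A t z)) =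
    scale A t powr (- real CARD('n) * (1 + A)) * profile m A \<gamma> (fst z) (snd z)"
proof -
  have "profile m A \<gamma> (fst (flow A t z) /\<^sub>R scale A t) (rel_velocity A t (fst (flow A t z)) (snd (flow A t z))) =
      profile m A \<gamma> (fst z) (snd z)"
    using profile_energy[of m A \<gamma> "(fst (flow A t z) /\<^sub>R scale A t, rel_velocity A t (fst (flow A t z)) (snd (flow A t z)))"]
    unfolding energy_flow[OF assms] profile_energy[symmetric] by simp
  then show ?thesis by (simp add: self_similar_def rel_velocity_def)
qed

lemma measurable_self_similar:
  "(\<lambda>z. self_similar m A \<gamma> t (fst z) (snd z :: real^'n)) \<in> borel_measurable borel"
proof -
  have "(\<lambda>z. (fst z /\<^sub>R scale A t, snd z /\<^sub>R (scale A t powr A) - fst z /\<^sub>R scale A t))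
      \<in> borel_measurable (borel :: ((real^'n) \<times> (real^'n)) measure)"
    by (intro borel_measurable_continuous_onI continuous_intros)
  from measurable_compose[OF this measurable_profile[of m A \<gamma>]]
  show ?thesis unfolding self_similar_def by simp
qed

text \<open>The self-similar function at time \<open>t\<close> is the density of the image of the profile under the flow: the
  prefactor \<open>scale A t powr (- d * (1 + A))\<close> is the inverse of the Jacobian of the flow.\<close>

lemma integral_self_similar:
  fixes \<psi> :: "(real^'n) \<times> (real^'n) \<Rightarrow> real"
  assumes A: "0 < A" "A < 1" and t: "0 < t" and \<psi>: "\<psi> \<in> borel_measurable borel"
  shows "integrable lborel (\<lambda>z. self_similar m A \<gamma> t (fst z) (snd z) * \<psi> z) \<longleftrightarrow>
      integrable lborel (\<lambda>z. profile m A \<gamma> (fst z) (snd z) * \<psi> (flow A t z))"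
    and "(LINT z|lborel. self_similar m A \<gamma> t (fst z) (snd z) * \<psi> z) =
      (LINT z|lborel. profile m A \<gamma> (fst z) (snd z) * \<psi> (flow A t z))"
proof -
  define R where "R = scale A t"
  have R: "0 < R" unfolding R_def using scale_pos[OF A(2) t] .
  define C where "C = rot_cos A t"
  define S where "S = rot_sin A t"
  define f where "f = (\<lambda>z. self_similar m A \<gamma> t (fst z) (snd z) * \<psi> z)"
  have f: "f \<in> borel_measurable borel"
    unfolding f_def by (intro borel_measurable_times measurable_self_similar \<psi>)
  \<comment> \<open>The determinant of the oscillator part is \<open>C ^ 2 + A * S ^ 2 = 1\<close>.\<close>
  have "R * C * (R powr A * (C + S)) - R * S * (R powr A * (C - A * S)) =
      R powr 1 * R powr A * (C\<^sup>2 + A * S\<^sup>2)"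
    using R by (simp add: algebra_simps power2_eq_square)
  then have det: "R * C * (R powr A * (C + S)) - R * S * (R powr A * (C - A * S)) = R powr (1 + A)"
    unfolding powr_add[symmetric] C_def S_def rot_identity[OF A(1)] by simp
  have flow: "flow A t = block_map (R * C) (R * S) (R powr A * (C - A * S)) (R powr A * (C + S))"
    unfolding flow_def R_def C_def S_def ..
  have fz: "f (flow A t z) = R powr (- real CARD('n) * (1 + A)) * (profile m A \<gamma> (fst z) (snd z) * \<psi> (flow A t z))" for z
    unfolding f_def self_similar_flow[OF A t] R_def by simp
  have inv: "\<bar>R powr (1 + A)\<bar> ^ DIM(real^'n) * R powr (- real CARD('n) * (1 + A)) = 1"
  proof -
    have "\<bar>R powr (1 + A)\<bar> ^ DIM(real^'n) = R powr ((1 + A) * real CARD('n))"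
      using R by (simp add: powr_powr[symmetric] powr_realpow)
    then show ?thesis using R by (simp add: powr_add[symmetric] algebra_simps)
  qed
  have ne: "R * C * (R powr A * (C + S)) - R * S * (R powr A * (C - A * S)) \<noteq> 0"
    unfolding det using R by simp
  show "integrable lborel (\<lambda>z. self_similar m A \<gamma> t (fst z) (snd z) * \<psi> z) \<longleftrightarrow>
      integrable lborel (\<lambda>z. profile m A \<gamma> (fst z) (snd z) * \<psi> (flow A t z))"
    using integral_block_map(1)[OF f ne] R
    unfolding flow[symmetric] fz by (simp add: f_def)
  have "(LINT z|lborel. f z) = \<bar>R powr (1 + A)\<bar> ^ DIM(real^'n) * (R powr (- real CARD('n) * (1 + A)) *
      (LINT z|lborel. profile m A \<gamma> (fst z) (snd z) * \<psi> (flow A t z)))"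
    using integral_block_map(2)[OF f ne]
    unfolding flow[symmetric] fz det by simp
  then show "(LINT z|lborel. self_similar m A \<gamma> t (fst z) (snd z) * \<psi> z) =
      (LINT z|lborel. profile m A \<gamma> (fst z) (snd z) * \<psi> (flow A t z))"
    unfolding mult.assoc[symmetric] inv by (simp add: f_def)
qed

lemma continuous_on_scale [continuous_intros]:
  assumes "A < 1" "continuous_on S f" "\<And>z. z \<in> S \<Longrightarrow> 0 < f z"
  shows "continuous_on S (\<lambda>z. scale A (f z))"
proof -
  have "f z \<noteq> 0" if "z \<in> S" for z using assms(3)[OF that] by simp
  then show ?thesis unfolding scale_def using assms by (intro continuous_intros) auto
qed

lemma continuous_on_flow:
  fixes g :: "'b::t2_space \<Rightarrow> 'a::real_normed_vector \<times> 'a"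
  assumes "0 < A" "A < 1" "continuous_on S f" "continuous_on S g" "\<And>z. z \<in> S \<Longrightarrow> 0 < f z"
  shows "continuous_on S (\<lambda>z. flow A (f z) (g z))"
proof -
  have "\<And>z. z \<in> S \<Longrightarrow> scale A (f z) \<noteq> 0" using scale_pos assms by (metis less_irrefl)
  then show ?thesis
    unfolding flow_def block_map_def rot_cos_def rot_sin_def case_prod_beta
    by (intro continuous_intros assms) (use assms in auto)
qed

lemma continuous_on_acceleration:
  fixes x v :: "'b::t2_space \<Rightarrow> 'a::real_normed_vector"
  assumes "A < 1" "continuous_on S f" "continuous_on S x" "continuous_on S v" "\<And>z. z \<in> S \<Longrightarrow> 0 < f z"
  shows "continuous_on S (\<lambda>z. acceleration A (f z) (x z) (v z))"
proof -
  have "\<And>z. z \<in> S \<Longrightarrow> scale A (f z) \<noteq> 0" using scale_pos assms by (metis less_irrefl)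
  then show ?thesis
    unfolding acceleration_def rel_velocity_def
    by (intro continuous_intros assms) (use assms in auto)
qed

lemma scale_tendsto_0:
  assumes "A < 1"
  shows "(scale A \<longlongrightarrow> 0) (at_right 0)"
proof -
  have "((\<lambda>t. (1 - A) * t) \<longlongrightarrow> (1 - A) * 0) (at_right 0)"
    by (intro tendsto_intros)
  moreover have "\<forall>\<^sub>F t in at_right 0. 0 \<le> (1 - A) * t"
    using eventually_at_right_less[of 0] by eventually_elim (use assms in simp)
  ultimately show ?thesis
    unfolding scale_def[abs_def] using assms by (intro tendsto_zero_powrI) auto
qed

lemma flow_tendsto_0:
  fixes z :: "'a::real_normed_vector \<times> 'a"
  assumes A: "0 < A" "A < 1"
  shows "((\<lambda>t. flow A t z) \<longlongrightarrow> 0) (at_right 0)"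
proof -
  have small: "((\<lambda>t. g t * h t) \<longlongrightarrow> 0) (at_right 0)"
    if "(g \<longlongrightarrow> 0) (at_right 0)" "\<And>t. \<bar>h t\<bar> \<le> B" for g h :: "real \<Rightarrow> real" and B
  proof (rule tendsto_0_le[OF that(1), of _ B])
    show "\<forall>\<^sub>F t in at_right 0. norm (g t * h t) \<le> norm (g t) * B"
      using that(2) by (intro always_eventually allI) (auto simp: abs_mult intro!: mult_left_mono)
  qed
  have C: "\<bar>rot_cos A t\<bar> \<le> 1" for t by (simp add: rot_cos_def)
  have S: "\<bar>rot_sin A t\<bar> \<le> 1 / sqrt A" for t
    using A by (auto simp: rot_sin_def abs_divide intro!: divide_right_mono)
  have AS: "\<bar>A * rot_sin A t\<bar> \<le> A * (1 / sqrt A)" for t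
    using mult_left_mono[OF S[of t], of A] A by (simp add: abs_mult)
  note R = scale_tendsto_0[OF A(2)]
  have RA: "((\<lambda>t. scale A t powr A) \<longlongrightarrow> 0) (at_right 0)"
  proof (rule tendsto_zero_powrI[OF R, of _ A])
    show "\<forall>\<^sub>F t in at_right 0. 0 \<le> scale A t" by (simp add: scale_def)
  qed (use A in auto)
  have CS: "\<bar>rot_cos A t + rot_sin A t\<bar> \<le> 1 + 1 / sqrt A"
    "\<bar>rot_cos A t - A * rot_sin A t\<bar> \<le> 1 + A * (1 / sqrt A)" for t
    using C[of t] S[of t] AS[of t] by linarith+
  have "((\<lambda>t. flow A t z) \<longlongrightarrow> (0 *\<^sub>R fst z + 0 *\<^sub>R snd z, 0 *\<^sub>R fst z + 0 *\<^sub>R snd z)) (at_right 0)"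
    unfolding flow_def block_map_def case_prod_beta
    by (intro tendsto_intros small[OF R C] small[OF R S] small[OF RA CS(1)] small[OF RA CS(2)])
  then show ?thesis by (simp add: zero_prod_def)
qed

text \<open>After the substitution by the flow the time dependence sits in \<open>\<psi> (flow A t z)\<close> alone, which is
  bounded and tends to \<open>\<psi> 0\<close>; dominated convergence applies.\<close>

lemma self_similar_concentrates:
  fixes \<psi> :: "(real^'n) \<times> (real^'n) \<Rightarrow> real"
  assumes A: "0 < A" "A < 1" and int: "integrable lborel (\<lambda>z. profile m A \<gamma> (fst z) (snd z :: real^'n))"
    and \<psi>: "continuous_on UNIV \<psi>" "bounded (range \<psi>)"
  shows "((\<lambda>t. LINT z|lborel. self_similar m A \<gamma> t (fst z) (snd z) * \<psi> z) \<longlongrightarrow>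
      (LINT z|lborel. profile m A \<gamma> (fst z) (snd z :: real^'n)) * \<psi> 0) (at_right 0)"
proof -
  have \<psi>m: "\<psi> \<in> borel_measurable borel" using \<psi> by (intro borel_measurable_continuous_onI)
  obtain B where "\<forall>y\<in>range \<psi>. norm y \<le> B" using \<psi>(2) unfolding bounded_iff by blast
  then have B: "\<bar>\<psi> z\<bar> \<le> B" for z by (metis rangeI real_norm_def)
  have "((\<lambda>t. LINT z|lborel. profile m A \<gamma> (fst z) (snd z) * \<psi> (flow A t z)) \<longlongrightarrow>
      (LINT z|lborel. profile m A \<gamma> (fst z) (snd z :: real^'n) * \<psi> 0)) (at_right 0)"
    unfolding tendsto_at_iff_sequentially o_def
  proof (intro allI impI)
    fix T :: "nat \<Rightarrow> real"
    assume T: "\<forall>i. T i \<in> {0<..} - {0}" "T \<longlonglongrightarrow> 0"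
    define g where "g = (\<lambda>z :: (real^'n) \<times> (real^'n). profile m A \<gamma> (fst z) (snd z))"
    have g: "integrable lborel g" "g \<in> borel_measurable borel" "\<And>z. 0 \<le> g z"
      unfolding g_def by (rule int, rule measurable_profile, simp add: profile_def)
    have "filterlim T (at_right 0) sequentially"
    proof -
      have "T i \<in> {0<..} \<and> T i \<noteq> 0" for i using T(1) by fastforce
      then show ?thesis unfolding filterlim_at using T(2) by (blast intro: always_eventually)
    qed
    then have flow0: "(\<lambda>n. flow A (T n) z) \<longlonglongrightarrow> 0" for z :: "(real^'n) \<times> (real^'n)"
      by (rule filterlim_compose[OF flow_tendsto_0[OF A]])
    have "(\<lambda>n. LINT z|lborel. g z * \<psi> (flow A (T n) z)) \<longlonglongrightarrow> (LINT z|lborel. g z * \<psi> 0)"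
    proof (rule integral_dominated_convergence[where w = "\<lambda>z. g z * B"])
      have "(\<lambda>z. \<psi> (flow A t z)) \<in> borel_measurable borel" for t
        using measurable_compose[OF measurable_block_map \<psi>m] unfolding flow_def by simp
      then show "(\<lambda>z. g z * \<psi> (flow A (T n) z)) \<in> borel_measurable lborel" for n
        using g(2) by simp
      show "AE z in lborel. (\<lambda>n. g z * \<psi> (flow A (T n) z)) \<longlonglongrightarrow> g z * \<psi> 0"
      proof (intro AE_I2 tendsto_mult_left)
        fix z :: "(real^'n) \<times> (real^'n)"
        show "(\<lambda>n. \<psi> (flow A (T n) z)) \<longlonglongrightarrow> \<psi> 0"
        proof (rule isCont_tendsto_compose[OF _ flow0])
          show "isCont \<psi> 0" using \<psi>(1) continuous_on_eq_continuous_at[of UNIV \<psi>] by blast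
        qed
      qed
      show "AE z in lborel. norm (g z * \<psi> (flow A (T n) z)) \<le> g z * B" for n
        using mult_left_mono[OF B g(3)] by (intro AE_I2) (simp add: abs_mult abs_of_nonneg[OF g(3)])
    qed (use g in auto)
    then show "(\<lambda>n. LINT z|lborel. profile m A \<gamma> (fst z) (snd z) * \<psi> (flow A (T n) z)) \<longlonglongrightarrow>
      (LINT z|lborel. profile m A \<gamma> (fst z) (snd z :: real^'n) * \<psi> 0)"
      unfolding g_def .
  qed
  moreover have "\<forall>\<^sub>F t in at_right 0. (LINT z|lborel. self_similar m A \<gamma> t (fst z) (snd z) * \<psi> z) =
      (LINT z|lborel. profile m A \<gamma> (fst z) (snd z) * \<psi> (flow A t z))"
    using eventually_at_right_less[of 0]
    by eventually_elim (rule integral_self_similar(2)[OF A _ \<psi>m])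
  ultimately show ?thesis
    by (simp add: tendsto_cong)
qed

section \<open>The transport equation along characteristics\<close>

lemma smooth_partial:
  fixes \<phi> :: "real \<times> (real^'n) \<times> (real^'n) \<Rightarrow> real"
  assumes \<phi>: "smooth \<phi>"
  shows "smooth (partial_t \<phi>)" "smooth (partial_x i \<phi>)" "smooth (partial_v i \<phi>)"
  using smooth_frechet_derivative[OF \<phi>] partial_derivatives_smooth[OF \<phi>]
  by (metis (no_types, lifting) ext)+

lemma continuous_kinetic_derivative:
  fixes \<phi> :: "real \<times> (real^'n) \<times> (real^'n) \<Rightarrow> real"
  assumes \<phi>: "smooth \<phi>" and a: "continuous_on S a"
  shows "continuous_on S (\<lambda>z. frechet_derivative \<phi> (at z) (1, snd (snd z), a z))"
proof -
  have eq: "frechet_derivative \<phi> (at z) (1, snd (snd z), a z) =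
      partial_t \<phi> z + (\<Sum>i\<in>UNIV. snd (snd z) $ i * partial_x i \<phi> z) + (\<Sum>i\<in>UNIV. a z $ i * partial_v i \<phi> z)" for z
  proof -
    have lin: "linear (frechet_derivative \<phi> (at z))"
      using smooth_has_derivative[OF \<phi>] has_derivative_linear by blast
    have "frechet_derivative \<phi> (at z) (1, snd (snd z), a z) =
        frechet_derivative \<phi> (at z) (1, snd (snd z), 0) + frechet_derivative \<phi> (at z) (0, 0, a z)"
      using linear_add[OF lin, of "(1, snd (snd z), 0)" "(0, 0, a z)"] by simp
    then show ?thesis
      using kinetic_operators_smooth(1)[OF \<phi>, of "fst z" "fst (snd z)" "snd (snd z)"]
        kinetic_operators_smooth(2)[OF \<phi>, of "a z" z]
      by (simp add: transport_def case_prod_beta)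
  qed
  have cont: "continuous_on S (partial_t \<phi>)" "continuous_on S (partial_x i \<phi>)" "continuous_on S (partial_v i \<phi>)" for i
    using smooth_partial[OF \<phi>, THEN smooth_continuous] by (blast intro: continuous_on_subset)+
  show ?thesis
    unfolding eq by (intro continuous_intros cont a)
qed

lemma continuous_self_similar:
  assumes m: "0 < m" "m \<noteq> 1" and A: "0 < A" "A < 1" and \<gamma>: "(1 - m) * \<gamma> > 0"
  shows "continuous_on positive_times (\<lambda>z. self_similar m A \<gamma> (fst z) (fst (snd z)) (snd (snd z) :: real^'n))"
proof -
  have pos: "scale A (fst z) \<noteq> 0" if "z \<in> positive_times" for z :: "real \<times> (real^'n) \<times> (real^'n)"
    using scale_pos[OF A(2), of "fst z"] that by auto
  have sc: "continuous_on positive_times (\<lambda>z :: real \<times> (real^'n) \<times> (real^'n). scale A (fst z))"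
    using A by (intro continuous_intros) auto
  have "continuous_on positive_times (\<lambda>z :: real \<times> (real^'n) \<times> (real^'n).
      (fst (snd z) /\<^sub>R scale A (fst z), snd (snd z) /\<^sub>R (scale A (fst z) powr A) - fst (snd z) /\<^sub>R scale A (fst z)))"
    by (intro continuous_intros sc) (use pos in auto)
  from continuous_on_compose2[OF continuous_profile[OF m less_imp_le[OF A(1)] \<gamma>, of UNIV] this]
  have "continuous_on positive_times (\<lambda>z :: real \<times> (real^'n) \<times> (real^'n).
      profile m A \<gamma> (fst (snd z) /\<^sub>R scale A (fst z))
        (snd (snd z) /\<^sub>R (scale A (fst z) powr A) - fst (snd z) /\<^sub>R scale A (fst z)))" by simp
  then show ?thesis
    unfolding self_similar_def by (intro continuous_intros sc) (use pos in auto)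
qed

text \<open>The integrand is the time derivative of \<open>\<phi>\<close> along the characteristic labelled by \<open>y\<close>, and \<open>\<phi>\<close>
  vanishes for small and for large times.\<close>

lemma integral_along_characteristic:
  fixes \<phi> :: "real \<times> (real^'n) \<times> (real^'n) \<Rightarrow> real"
  assumes A: "0 < A" "A < 1"
    and \<phi>: "smooth \<phi>" and K: "compact K" "K \<subseteq> positive_times" "\<And>z. z \<notin> K \<Longrightarrow> \<phi> z = 0"
  shows "(LINT t|lborel. indicator {0<..} t * frechet_derivative \<phi> (at (t, flow A t y))
      (1, snd (flow A t y), acceleration A t (fst (flow A t y)) (snd (flow A t y)))) = 0"
proof -
  define H where "H = (\<lambda>t. if 0 < t then \<phi> (t, flow A t y) else 0)"
  define h where "h = (\<lambda>t. frechet_derivative \<phi> (at (t, flow A t y))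
      (1, snd (flow A t y), acceleration A t (fst (flow A t y)) (snd (flow A t y))))"
  define H' where "H' = (\<lambda>t. indicator {0<..} t * h t)"
  have T: "compact (fst ` K)" "fst ` K \<subseteq> {0<..}"
  proof -
    show "compact (fst ` K)"
      by (intro compact_continuous_image continuous_on_fst continuous_on_id K(1))
    have "fst z \<in> {0<..}" if "z \<in> K" for z
      using subsetD[OF K(2) that] by (simp add: mem_Times_iff)
    then show "fst ` K \<subseteq> {0<..}" by blast
  qed
  have H0: "H t = 0" if "t \<notin> fst ` K" for t
  proof -
    have "(t, flow A t y) \<notin> K" using that by force
    then show ?thesis using K(3) by (simp add: H_def)
  qed
  have H'0: "H' t = 0" if "t \<notin> fst ` K" for t
  proof -
    have "(t, flow A t y) \<notin> K" using that by force
    then show ?thesis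
      using frechet_derivative_eq_0[of K \<phi>] compact_imp_closed[OF K(1)] K(3) by (simp add: H'_def h_def)
  qed
  have flow: "continuous_on {0<..} (\<lambda>t. flow A t y)"
    using A by (intro continuous_on_flow continuous_intros) auto
  have Hcont: "continuous_on UNIV H"
  proof (rule continuous_on_extend_zero[OF _ _ T H0])
    have "continuous_on {0<..} (\<lambda>t. \<phi> (t, flow A t y))"
      by (rule continuous_on_compose2[OF smooth_continuous[OF \<phi>]]) (intro continuous_intros flow | simp)+
    then show "continuous_on {0<..} H"
      by (subst continuous_on_cong[OF refl, of _ _ "\<lambda>t. \<phi> (t, flow A t y)"]) (auto simp: H_def)
  qed simp_all
  have H'cont: "continuous_on UNIV H'"
  proof (rule continuous_on_extend_zero[OF _ _ T H'0])
    have acc: "continuous_on positive_times (\<lambda>z :: real \<times> (real^'n) \<times> (real^'n). acceleration A (fst z) (fst (snd z)) (snd (snd z)))"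
      using A by (intro continuous_on_acceleration continuous_intros) auto
    have curve: "continuous_on {0<..} (\<lambda>t. (t, flow A t y))"
      by (intro continuous_intros flow)
    have "continuous_on {0<..} h"
      using continuous_on_compose2[OF continuous_kinetic_derivative[OF \<phi> acc] curve]
      by (auto simp: h_def)
    then show "continuous_on {0<..} H'"
      by (subst continuous_on_cong[OF refl, of _ _ h]) (auto simp: H'_def)
  qed simp_all
  have "(LINT t|lborel. H' t) = 0"
  proof (rule integral_directional_derivative_eq_0[where H = H and e = 1 and K = "fst ` K"])
    fix t
    have "(H has_real_derivative H' t) (at t)"
    proof (cases "0 < t")
      case True
      have "((\<lambda>t. (t, flow A t y)) has_vector_derivative
          (1, snd (flow A t y), acceleration A t (fst (flow A t y)) (snd (flow A t y)))) (at t)"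
        by (intro has_vector_derivative_Pair flow_solves A True has_vector_derivative_id)
      from smooth_directional_derivative[OF \<phi> this]
      have "((\<lambda>t. \<phi> (t, flow A t y)) has_real_derivative H' t) (at t)"
        using True by (simp add: H'_def h_def)
      then show ?thesis
        by (rule has_field_derivative_transform_within_open[of _ _ _ "{0<..}"]) (use True in \<open>auto simp: H_def\<close>)
    next
      case False
      then have t: "t \<in> - fst ` K" using T(2) by auto
      have "((\<lambda>_. 0) has_real_derivative H' t) (at t)" using H'0 t by simp
      then show ?thesis
      proof (rule has_field_derivative_transform_within_open)
        show "open (- fst ` K)" using T(1) by (simp add: compact_imp_closed open_Compl)
      qed (use t H0 in auto)
    qed
    then show "((\<lambda>s. H (t + s *\<^sub>R 1)) has_real_derivative H' t) (at 0)"
      using DERIV_shift[of H "H' t" 0 t] by (simp add: add.commute)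
  qed (use Hcont H'cont T H0 H'0 in auto)
  then show ?thesis by (simp add: H'_def h_def)
qed

text \<open>The weak form of the continuity equation with the field \<open>(v, acceleration)\<close>: on each time slice
  replace \<open>self_similar\<close> by the profile and the test function by its pullback under the flow, then
  exchange the integrals over time and over the characteristics.\<close>

lemma self_similar_transport:
  fixes \<phi> :: "real \<times> (real^'n) \<times> (real^'n) \<Rightarrow> real"
  assumes m: "0 < m" "m \<noteq> 1" and A: "0 < A" "A < 1" and \<gamma>: "(1 - m) * \<gamma> > 0"
    and int: "integrable lborel (\<lambda>z. profile m A \<gamma> (fst z) (snd z :: real^'n))"
    and \<phi>: "smooth \<phi>" and K: "compact K" "K \<subseteq> positive_times" "\<And>z. z \<notin> K \<Longrightarrow> \<phi> z = 0"
  shows "(LINT z|lborel. self_similar m A \<gamma> (fst z) (fst (snd z)) (snd (snd z)) *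
      frechet_derivative \<phi> (at z) (1, snd (snd z), acceleration A (fst z) (fst (snd z)) (snd (snd z)))) = 0"
proof -
  define f where "f = (\<lambda>z::real \<times> (real^'n) \<times> (real^'n). self_similar m A \<gamma> (fst z) (fst (snd z)) (snd (snd z)))"
  define \<xi> where "\<xi> = (\<lambda>z. frechet_derivative \<phi> (at z) (1, snd (snd z), acceleration A (fst z) (fst (snd z)) (snd (snd z))))"
  define g where "g = (\<lambda>z::(real^'n) \<times> (real^'n). profile m A \<gamma> (fst z) (snd z))"
  have g: "integrable lborel g" "g \<in> borel_measurable borel"
    unfolding g_def by (rule int, rule measurable_profile)
  have T: "compact (fst ` K)"
    by (intro compact_continuous_image continuous_on_fst continuous_on_id K(1))
  have \<xi>0: "\<xi> z = 0" if "z \<notin> K" for z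
    unfolding \<xi>_def using frechet_derivative_eq_0[of K \<phi>] compact_imp_closed[OF K(1)] K(3) that by blast
  have "continuous_on positive_times (\<lambda>z :: real \<times> (real^'n) \<times> (real^'n). acceleration A (fst z) (fst (snd z)) (snd (snd z)))"
    using A by (intro continuous_on_acceleration continuous_intros) auto
  then have \<xi>cont: "continuous_on positive_times \<xi>"
    unfolding \<xi>_def by (rule continuous_kinetic_derivative[OF \<phi>])
  have opn: "open (positive_times :: (real \<times> (real^'n) \<times> (real^'n)) set)"
    by (intro open_Times) auto
  have \<xi>cont': "continuous_on UNIV \<xi>"
    by (rule continuous_on_extend_zero[OF \<xi>cont opn K(1,2) \<xi>0])
  have "bounded (\<xi> ` K)"
    using K(1) \<xi>cont' by (intro compact_imp_bounded compact_continuous_image) (auto intro: continuous_on_subset)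
  then obtain B0 where B0: "\<forall>y\<in>\<xi> ` K. norm y \<le> B0" unfolding bounded_iff by blast
  define B where "B = max B0 0"
  have B: "\<bar>\<xi> z\<bar> \<le> B" for z
  proof (cases "z \<in> K")
    case True
    then have "norm (\<xi> z) \<le> B0" using B0 by blast
    then show ?thesis by (simp add: B_def)
  next
    case False
    then show ?thesis using \<xi>0 by (simp add: B_def)
  qed
  have Fint: "integrable lborel (\<lambda>z. f z * \<xi> z)"
  proof (rule integrable_continuous_compact_support[OF continuous_on_extend_zero[OF _ opn K(1,2)] K(1)])
    show "continuous_on positive_times (\<lambda>z. f z * \<xi> z)"
      unfolding f_def by (intro continuous_on_mult \<xi>cont continuous_self_similar[OF m A \<gamma>])
  qed (use \<xi>0 in simp_all)
  \<comment> \<open>The integrand at time \<open>t\<close> in terms of the label \<open>z\<close> of the characteristic.\<close>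
  define G where "G = (\<lambda>t z. g z * (indicator {0<..} t * \<xi> (t, flow A t z)))"
  have slice: "(LINT p|lborel. f (t, p) * \<xi> (t, p)) = (LINT z|lborel. G t z)" for t
  proof (cases "0 < t")
    case True
    have "continuous_on UNIV (\<lambda>p. \<xi> (t, p))"
      by (rule continuous_on_compose2[OF \<xi>cont']) (intro continuous_intros | simp)+
    then have "(\<lambda>p. \<xi> (t, p)) \<in> borel_measurable borel"
      by (rule borel_measurable_continuous_onI)
    from integral_self_similar(2)[OF A True this, of m \<gamma>] show ?thesis
      using True by (simp add: f_def G_def g_def)
  next
    case False
    then have "(t, p) \<notin> K" for p using K(2) by auto
    then show ?thesis using False \<xi>0 by (simp add: G_def)
  qed
  have Gm: "case_prod G \<in> borel_measurable (lborel \<Otimes>\<^sub>M lborel)"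
  proof -
    have "continuous_on ({0<..} \<times> UNIV) (\<lambda>(t, z). \<xi> (t, flow A t z))"
      unfolding case_prod_beta
      by (rule continuous_on_compose2[OF \<xi>cont', where f = "\<lambda>w. (fst w, flow A (fst w) (snd w))"])
        (use A in \<open>auto intro!: continuous_intros continuous_on_flow\<close>)
    from borel_measurable_continuous_on_indicator[OF _ this]
    have "(\<lambda>w. indicator ({0<..} \<times> UNIV) w *\<^sub>R (case w of (t, z) \<Rightarrow> \<xi> (t, flow A t z))) \<in> borel_measurable borel"
      using opn by (simp add: borel_open)
    moreover have "(\<lambda>w. g (snd w)) \<in> borel_measurable borel"
      by (rule measurable_compose[OF _ g(2)]) (intro borel_measurable_continuous_onI continuous_intros)
    ultimately have "(\<lambda>w. g (snd w) * (indicator ({0<..} \<times> UNIV) w *\<^sub>R (case w of (t, z) \<Rightarrow> \<xi> (t, flow A t z))))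
        \<in> borel_measurable borel"
      by (rule borel_measurable_times[rotated])
    also have "(\<lambda>w. g (snd w) * (indicator ({0<..} \<times> UNIV) w *\<^sub>R (case w of (t, z) \<Rightarrow> \<xi> (t, flow A t z)))) = case_prod G"
      by (auto simp: G_def fun_eq_iff indicator_def)
    finally show ?thesis by (simp add: lborel_prod)
  qed
  have Gint: "integrable (lborel \<Otimes>\<^sub>M lborel) (case_prod G)"
  proof (rule Bochner_Integration.integrable_bound[OF _ Gm])
    have a: "integrable lborel (\<lambda>t. indicator (fst ` K) t * B :: real)"
    proof -
      have "integrable lborel (\<lambda>t. indicator (fst ` K) t *\<^sub>R B)"
        using T by (intro borel_integrable_compact) auto
      then show ?thesis by simp
    qed
    show "integrable (lborel \<Otimes>\<^sub>M lborel) (\<lambda>(t, z). (indicator (fst ` K) t * B) * g z)"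
    proof (rule lborel_pair.Fubini_integrable)
      have [measurable]: "g \<in> borel_measurable borel" by (rule g(2))
      have [measurable]: "fst ` K \<in> sets borel" using T by (simp add: compact_imp_closed borel_closed)
      show "(\<lambda>(t, z). (indicator (fst ` K) t * B) * g z) \<in> borel_measurable (lborel \<Otimes>\<^sub>M lborel)"
        by measurable
      show "integrable lborel (\<lambda>t. LINT z|lborel. norm (case (t, z) of (t, z) \<Rightarrow> (indicator (fst ` K) t * B) * g z))"
        using integrable_norm[OF a] by (simp add: abs_mult)
      show "AE t in lborel. integrable lborel (\<lambda>z. case (t, z) of (t, z) \<Rightarrow> (indicator (fst ` K) t * B) * g z)"
        using g(1) by simp
    qed
    show "AE w in lborel \<Otimes>\<^sub>M lborel. norm (case_prod G w) \<le> norm (case w of (t, z) \<Rightarrow> (indicator (fst ` K) t * B) * g z)"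
    proof (rule AE_I2, clarify)
      fix t and y z :: "real^'n"
      show "norm (G t (y, z)) \<le> norm ((indicator (fst ` K) t * B) * g (y, z))"
      proof (cases "t \<in> fst ` K")
        case True
        have "norm (G t (y, z)) \<le> \<bar>g (y, z)\<bar> * \<bar>\<xi> (t, flow A t (y, z))\<bar>"
          by (auto simp: G_def abs_mult indicator_def)
        also have "\<dots> \<le> \<bar>g (y, z)\<bar> * B" using B by (intro mult_left_mono) auto
        finally show ?thesis using True by (simp add: abs_mult B_def mult.commute)
      next
        case False
        then have "(t, flow A t (y, z)) \<notin> K" by force
        then show ?thesis using \<xi>0 by (simp add: G_def)
      qed
    qed
  qed
  have "(LINT z|lborel. f z * \<xi> z) = (LINT t|lborel. LINT p|lborel. f (t, p) * \<xi> (t, p))"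
    using lborel_pair.integral_fst'[of "\<lambda>z. f z * \<xi> z"] Fint by (simp add: lborel_prod)
  also have "\<dots> = (LINT t|lborel. LINT z|lborel. G t z)" unfolding slice ..
  also have "\<dots> = (LINT z|lborel. LINT t|lborel. G t z)"
    by (rule lborel_pair.Fubini_integral[OF Gint, symmetric])
  also have "\<dots> = 0"
    using integral_along_characteristic[OF A \<phi> K] by (simp add: G_def \<xi>_def)
  finally show ?thesis unfolding f_def \<xi>_def .
qed

section \<open>The diffusion term\<close>

text \<open>At \<open>s = 0\<close> the exponent \<open>p > 1\<close> makes both one-sided derivatives vanish.\<close>

lemma DERIV_pos_part_powr:
  fixes s p :: real
  assumes "0 < s \<or> 1 < p"
  shows "((\<lambda>s. max 0 s powr p) has_real_derivative p * max 0 s powr (p - 1)) (at s)"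
proof -
  consider "0 < s" | "s < 0" "1 < p" | "s = 0" "1 < p" using assms by linarith
  then show ?thesis
  proof cases
    case 1
    have "((\<lambda>s. s powr p) has_real_derivative p * max 0 s powr (p - 1)) (at s)"
      using 1 by (auto intro!: derivative_eq_intros simp: powr_diff)
    then show ?thesis
      by (rule has_field_derivative_transform_within_open[of _ _ _ "{0<..}"]) (use 1 in auto)
  next
    case 2
    have "((\<lambda>s. 0) has_real_derivative p * max 0 s powr (p - 1)) (at s)"
      using 2 by simp
    then show ?thesis
      by (rule has_field_derivative_transform_within_open[of _ _ _ "{..<0}"]) (use 2 in auto)
  next
    case 3
    have "((\<lambda>h. \<bar>h\<bar> powr (p - 1)) \<longlongrightarrow> 0) (at (0::real))"
      using 3 by (intro tendsto_zero_powrI[of _ _ _ "p - 1"] tendsto_rabs_zero tendsto_ident_at) auto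
    moreover have bound: "norm (max 0 h powr p / h) \<le> \<bar>h\<bar> powr (p - 1)" for h :: real
    proof (cases "0 < h")
      case True
      then show ?thesis by (simp add: powr_diff)
    next
      case False
      then have "max 0 h = 0" by simp
      then show ?thesis by simp
    qed
    ultimately have "((\<lambda>h. max 0 h powr p / h) \<longlongrightarrow> 0) (at (0::real))"
      by (rule Lim_null_comparison[OF always_eventually, OF allI, rotated])
    then show ?thesis using 3 by (simp add: DERIV_def)
  qed
qed

lemma norm_add_axis_power2: "(norm (w + s *\<^sub>R axis i 1))\<^sup>2 = (norm w)\<^sup>2 + 2 * s * w $ i + s\<^sup>2" for w :: "real^'n"
  by (simp add: power2_norm_eq_inner inner_simps inner_axis inner_commute[of "axis i 1"])
    (simp add: power2_eq_square algebra_simps)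

text \<open>The factor \<open>m / (m - 1)\<close> from the chain rule cancels \<open>(1 - m) / m\<close> in the profile, and lowering
  the exponent to \<open>m / (m - 1) - 1 = 1 / (m - 1)\<close> gives back the profile itself.\<close>

lemma profile_power_deriv:
  fixes y w :: "real^'n"
  assumes m: "0 < m" "m \<noteq> 1" and A: "0 < A" and \<gamma>: "(1 - m) * \<gamma> > 0"
  shows "((\<lambda>h. profile m A \<gamma> y (w + (h * k) *\<^sub>R axis i 1) powr m) has_real_derivative
     - ((1 + A) * k * w $ i * profile m A \<gamma> y w)) (at 0)"
proof -
  define c where "c = (1 - m) / m"
  define B where "B h = c * (\<gamma> + (1 + A) / 2 * energy A (y, w + (h * k) *\<^sub>R axis i 1))" for h
  define p where "p = m / (m - 1)"
  have B: "(B has_real_derivative c * ((1 + A) * k * w $ i)) (at 0)"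
    unfolding B_def energy_def fst_conv snd_conv norm_add_axis_power2
    by (auto intro!: derivative_eq_intros simp: field_simps)
  have prof: "profile m A \<gamma> y (w + (h * k) *\<^sub>R axis i 1) = max 0 (B h) powr (1 / (m - 1))" for h
    using profile_energy[of m A \<gamma> "(y, w + (h * k) *\<^sub>R axis i 1)"] unfolding B_def c_def by simp
  have p1: "p - 1 = 1 / (m - 1)" and pc: "p * c = -1"
    using m by (auto simp: p_def c_def field_simps)
  have "0 < B 0 \<or> 1 < p"
    using profile_base_pos_or_exponent_pos[OF m less_imp_le[OF A] \<gamma>, of "(y, w)"] p1
    unfolding B_def c_def by (metis (no_types, lifting) add.right_neutral diff_gt_0_iff_gt mult_zero_left scaleR_zero_left)
  from DERIV_chain2[OF DERIV_pos_part_powr[OF this] B]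
  have "((\<lambda>h. max 0 (B h) powr p) has_real_derivative
      p * max 0 (B 0) powr (p - 1) * (c * ((1 + A) * k * w $ i))) (at 0)" .
  also have "p * max 0 (B 0) powr (p - 1) * (c * ((1 + A) * k * w $ i)) =
      (p * c) * ((1 + A) * k * w $ i * profile m A \<gamma> y w)"
    using prof[of 0] unfolding p1 by simp
  also have "(\<lambda>h. max 0 (B h) powr p) = (\<lambda>h. profile m A \<gamma> y (w + (h * k) *\<^sub>R axis i 1) powr m)"
    unfolding prof powr_powr p_def by simp
  finally show ?thesis unfolding pc by simp
qed

text \<open>The gradient of \<open>f powr m\<close> in \<open>v\<close> is \<open>- f\<close> times the acceleration of the characteristics. Here \<open>exponents\<close>
  is what makes the powers of \<open>scale A t\<close> agree.\<close>

lemma self_similar_power_deriv: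
  fixes x v :: "real^'n"
  assumes m: "0 < m" "m \<noteq> 1" and A: "0 < A" "A < 1" and \<gamma>: "(1 - m) * \<gamma> > 0"
    and exponents: "(1 + A) * (1 - m) * real CARD('n) = 3 * A - 1" and t: "0 < t"
  shows "((\<lambda>h. self_similar m A \<gamma> t x (v + h *\<^sub>R axis i 1) powr m) has_real_derivative
     - (acceleration A t x v $ i * self_similar m A \<gamma> t x v)) (at 0)"
proof -
  define R where "R = scale A t"
  define \<delta> where "\<delta> = - real CARD('n) * (1 + A)"
  define k where "k = inverse (R powr A)"
  define w where "w = rel_velocity A t x v"
  have R: "0 < R" unfolding R_def using scale_pos[OF A(2) t] .
  have shift: "(v + h *\<^sub>R axis i 1) /\<^sub>R (R powr A) - x /\<^sub>R R = w + (h * k) *\<^sub>R axis i 1" for h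
    by (simp add: w_def rel_velocity_def R_def k_def scaleR_add_right mult.commute)
  have eq: "self_similar m A \<gamma> t x (v + h *\<^sub>R axis i 1) powr m =
      R powr (\<delta> * m) * profile m A \<gamma> (x /\<^sub>R R) (w + (h * k) *\<^sub>R axis i 1) powr m" for h
  proof -
    have "0 \<le> profile m A \<gamma> (x /\<^sub>R R) (w + (h * k) *\<^sub>R axis i 1)" by (simp add: profile_def)
    then show ?thesis
      unfolding self_similar_def R_def[symmetric] \<delta>_def[symmetric] shift
      using R by (simp add: powr_mult powr_powr)
  qed
  have power: "R powr (\<delta> * m) * k = R powr (2 * A - 1) * R powr \<delta>"
  proof -
    have "\<delta> * m - A = 2 * A - 1 + \<delta>"
      using exponents unfolding \<delta>_def by (simp add: algebra_simps)
    moreover have "R powr (\<delta> * m) * k = R powr (\<delta> * m - A)"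
      by (simp add: k_def powr_diff divide_inverse)
    ultimately show ?thesis by (simp only: powr_add)
  qed
  have "R powr (\<delta> * m) * - ((1 + A) * k * w $ i * profile m A \<gamma> (x /\<^sub>R R) w) =
      - ((1 + A) * (R powr (\<delta> * m) * k) * w $ i * profile m A \<gamma> (x /\<^sub>R R) w)" by simp
  also have "\<dots> = - (acceleration A t x v $ i * self_similar m A \<gamma> t x v)"
    unfolding power acceleration_def self_similar_def R_def[symmetric] \<delta>_def[symmetric]
      rel_velocity_def[of A t x v, folded R_def, symmetric] w_def[symmetric]
    by simp
  finally have "R powr (\<delta> * m) * - ((1 + A) * k * w $ i * profile m A \<gamma> (x /\<^sub>R R) w) =
      - (acceleration A t x v $ i * self_similar m A \<gamma> t x v)" .
  with DERIV_cmult[OF profile_power_deriv[OF m A(1) \<gamma>, of "x /\<^sub>R R" w k i], of "R powr (\<delta> * m)"]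
  show ?thesis unfolding eq by simp
qed

text \<open>One integration by parts in each coordinate of \<open>v\<close>: the nonlinear diffusion acts on test functions as
  the linear first-order operator with velocity field \<open>acceleration\<close>.\<close>

lemma self_similar_diffusion:
  fixes \<phi> :: "real \<times> (real^'n) \<times> (real^'n) \<Rightarrow> real"
  assumes m: "0 < m" "m \<noteq> 1" and A: "0 < A" "A < 1" and \<gamma>: "(1 - m) * \<gamma> > 0"
    and exponents: "(1 + A) * (1 - m) * real CARD('n) = 3 * A - 1"
    and \<phi>: "smooth \<phi>" and K: "compact K" "K \<subseteq> positive_times" "\<And>z. z \<notin> K \<Longrightarrow> \<phi> z = 0"
  shows "(LINT z|lborel. self_similar m A \<gamma> (fst z) (fst (snd z)) (snd (snd z)) powr m * laplacian_v \<phi> z) =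
    (LINT z|lborel. self_similar m A \<gamma> (fst z) (fst (snd z)) (snd (snd z)) *
      frechet_derivative \<phi> (at z) (0, 0, acceleration A (fst z) (fst (snd z)) (snd (snd z))))"
proof -
  define f where "f = (\<lambda>z::real \<times> (real^'n) \<times> (real^'n). self_similar m A \<gamma> (fst z) (fst (snd z)) (snd (snd z)))"
  define a where "a = (\<lambda>z::real \<times> (real^'n) \<times> (real^'n). acceleration A (fst z) (fst (snd z)) (snd (snd z)))"
  have opn: "open (positive_times :: (real \<times> (real^'n) \<times> (real^'n)) set)"
    by (intro open_Times) auto
  have f: "continuous_on positive_times f" "0 \<le> f z" for z
    unfolding f_def by (rule continuous_self_similar[OF m A \<gamma>]) (simp add: self_similar_def profile_def)
  have fm: "continuous_on positive_times (\<lambda>z. f z powr m)"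
    using f m by (intro continuous_on_powr' continuous_intros) auto
  have a: "continuous_on positive_times a"
    unfolding a_def using A by (intro continuous_on_acceleration continuous_intros) auto
  note s = smooth_partial(3)[OF \<phi>]
  have p0: "partial_v i \<phi> z = 0" if "z \<notin> K" for i z
    unfolding partial_derivatives_smooth(3)[OF \<phi>]
    using frechet_derivative_eq_0[of K \<phi>] compact_imp_closed[OF K(1)] K(3) that by blast
  have pp0: "frechet_derivative (partial_v i \<phi>) (at z) e = 0" if "z \<notin> K" for i z e
    using frechet_derivative_eq_0[of K "partial_v i \<phi>"] compact_imp_closed[OF K(1)] p0 that by blast
  have cont: "continuous_on positive_times (partial_v i \<phi>)"
    "continuous_on positive_times (\<lambda>z. frechet_derivative (partial_v i \<phi>) (at z) e)" for i e
    using smooth_continuous[OF s] smooth_continuous[OF smooth_frechet_derivative[OF s]]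
    by (blast intro: continuous_on_subset)+
  have int: "integrable lborel (\<lambda>z. u z * b z)"
    if "continuous_on positive_times u" "continuous_on positive_times b" "\<And>z. z \<notin> K \<Longrightarrow> b z = 0"
    for u b :: "real \<times> (real^'n) \<times> (real^'n) \<Rightarrow> real"
    by (rule integrable_continuous_compact_support[OF continuous_on_extend_zero[OF continuous_on_mult[OF that(1,2)] opn K(1,2)] K(1)])
      (simp_all add: that(3))
  have ap: "continuous_on positive_times (\<lambda>z. a z $ i * f z)" for i
    by (intro continuous_intros a f(1))
  have parts: "(LINT z|lborel. f z powr m * frechet_derivative (partial_v i \<phi>) (at z) (0, 0, axis i 1)) =
      - (LINT z|lborel. - (a z $ i * f z) * partial_v i \<phi> z)" for i
  proof (rule integral_by_parts_compact_support[OF opn fm _ _ s K(1,2) p0])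
    show "continuous_on positive_times (\<lambda>z. - (a z $ i * f z))"
      by (intro continuous_on_minus ap)
    fix z :: "real \<times> (real^'n) \<times> (real^'n)" assume "z \<in> positive_times"
    then have t: "0 < fst z" by auto
    show "((\<lambda>h. f (z + h *\<^sub>R (0, 0, axis i 1)) powr m) has_real_derivative - (a z $ i * f z)) (at 0)"
      using self_similar_power_deriv[OF m A \<gamma> exponents t, of "fst (snd z)" "snd (snd z)" i]
      by (simp add: f_def a_def)
  qed
  have "(LINT z|lborel. f z powr m * laplacian_v \<phi> z) =
      (LINT z|lborel. (\<Sum>i\<in>UNIV. f z powr m * frechet_derivative (partial_v i \<phi>) (at z) (0, 0, axis i 1)))"
    by (simp add: kinetic_operators_smooth(3)[OF \<phi>] sum_distrib_left)
  also have "\<dots> = (\<Sum>i\<in>UNIV. (LINT z|lborel. f z powr m * frechet_derivative (partial_v i \<phi>) (at z) (0, 0, axis i 1)))"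
    by (intro Bochner_Integration.integral_sum int fm cont pp0)
  also have "\<dots> = (\<Sum>i\<in>UNIV. (LINT z|lborel. (a z $ i * f z) * partial_v i \<phi> z))"
    unfolding parts by simp
  also have "\<dots> = (LINT z|lborel. (\<Sum>i\<in>UNIV. (a z $ i * f z) * partial_v i \<phi> z))"
    by (intro Bochner_Integration.integral_sum[symmetric] int ap cont p0)
  also have "\<dots> = (LINT z|lborel. f z * frechet_derivative \<phi> (at z) (0, 0, a z))"
    by (simp add: kinetic_operators_smooth(2)[OF \<phi>, symmetric] sum_distrib_left mult_ac)
  finally show ?thesis unfolding f_def a_def .
qed

lemma distributional_solution_self_similar:
  assumes m: "0 < m" "m \<noteq> 1" and A: "0 < A" "A < 1" and \<gamma>: "(1 - m) * \<gamma> > 0"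
    and exponents: "(1 + A) * (1 - m) * real CARD('n) = 3 * A - 1"
    and int: "integrable lborel (\<lambda>z. profile m A \<gamma> (fst z) (snd z :: real^'n))"
  shows "distributional_solution m (self_similar m A \<gamma> :: real \<Rightarrow> real^'n \<Rightarrow> real^'n \<Rightarrow> real)"
proof -
  define f where "f = (\<lambda>z::real \<times> (real^'n) \<times> (real^'n). self_similar m A \<gamma> (fst z) (fst (snd z)) (snd (snd z)))"
  define a where "a = (\<lambda>z::real \<times> (real^'n) \<times> (real^'n). acceleration A (fst z) (fst (snd z)) (snd (snd z)))"
  have f: "continuous_on positive_times f" "0 \<le> f z" for z
    unfolding f_def by (rule continuous_self_similar[OF m A \<gamma>]) (simp add: self_similar_def profile_def)
  have fm: "continuous_on positive_times (\<lambda>z. f z powr m)"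
    using f m by (intro continuous_on_powr' continuous_intros) auto
  have loc: "locally_integrable u" if "continuous_on positive_times u"
    for u :: "real \<times> (real^'n) \<times> (real^'n) \<Rightarrow> real"
    unfolding locally_integrable_def set_integrable_def
    using that by (blast intro: borel_integrable_compact continuous_on_subset)
  have "- (LINT (t, x, v):positive_times|lborel.
        self_similar m A \<gamma> t x v * (partial_t \<phi> (t, x, v) + transport \<phi> (t, x, v))) =
      (LINT (t, x, v):positive_times|lborel. self_similar m A \<gamma> t x v powr m * laplacian_v \<phi> (t, x, v))"
    if "test_function \<phi>" for \<phi> :: "real \<times> (real^'n) \<times> (real^'n) \<Rightarrow> real"
  proof -
    define K where "K = closure {z. \<phi> z \<noteq> 0}"
    have \<phi>: "smooth \<phi>" and K: "compact K" "K \<subseteq> positive_times"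
      using that by (auto simp: test_function_def smooth_def K_def)
    have \<phi>0: "\<phi> z = 0" if "z \<notin> K" for z
      using that closure_subset[of "{z. \<phi> z \<noteq> 0}"] unfolding K_def by blast
    have D0: "frechet_derivative \<phi> (at z) e = 0" if "z \<notin> K" for z e
      using frechet_derivative_eq_0[of K \<phi>] compact_imp_closed[OF K(1)] \<phi>0 that by blast
    have pp0: "frechet_derivative (partial_v i \<phi>) (at z) e = 0" if "z \<notin> K" for i z e
      using frechet_derivative_eq_0[of K "partial_v i \<phi>"] compact_imp_closed[OF K(1)] D0 that
      unfolding partial_derivatives_smooth(3)[OF \<phi>] by blast
    have L0: "laplacian_v \<phi> z = 0" if "z \<notin> K" for z
      unfolding kinetic_operators_smooth(3)[OF \<phi>] using pp0[OF that] by simp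
    have unrestrict: "(LINT z:positive_times|lborel. u z * b z) = (LINT z|lborel. u z * b z)"
      if "\<And>z. z \<notin> K \<Longrightarrow> b z = 0" for u b :: "real \<times> (real^'n) \<times> (real^'n) \<Rightarrow> real"
      unfolding set_lebesgue_integral_def
    proof (rule Bochner_Integration.integral_cong[OF refl])
      fix z show "indicator positive_times z *\<^sub>R (u z * b z) = u z * b z"
        using that[of z] K(2) by (cases "z \<in> K") (auto simp: indicator_def)
    qed
    have lin: "linear (frechet_derivative \<phi> (at z))" for z
      using smooth_has_derivative[OF \<phi>] has_derivative_linear by blast
    have opn: "open (positive_times :: (real \<times> (real^'n) \<times> (real^'n)) set)"
      by (intro open_Times) auto
    have a: "continuous_on positive_times a"
      unfolding a_def using A by (intro continuous_on_acceleration continuous_intros) auto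
    have intD: "integrable lborel (\<lambda>z. f z * frechet_derivative \<phi> (at z) (1, snd (snd z), b z))"
      if "continuous_on positive_times b" for b
      by (rule integrable_continuous_compact_support[OF continuous_on_extend_zero[OF
              continuous_on_mult[OF f(1) continuous_kinetic_derivative[OF \<phi> that]] opn K] K(1)])
        (simp_all add: D0)
    have "(LINT (t, x, v):positive_times|lborel.
        self_similar m A \<gamma> t x v * (partial_t \<phi> (t, x, v) + transport \<phi> (t, x, v))) =
        (LINT z:positive_times|lborel. f z * frechet_derivative \<phi> (at z) (1, snd (snd z), 0))"
      unfolding kinetic_operators_smooth(1)[OF \<phi>] f_def by (simp add: case_prod_unfold)
    also have "\<dots> = (LINT z|lborel. f z * frechet_derivative \<phi> (at z) (1, snd (snd z), 0))"
      using D0 by (rule unrestrict)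
    also have "\<dots> = (LINT z|lborel. f z * frechet_derivative \<phi> (at z) (1, snd (snd z), a z)
        - f z * frechet_derivative \<phi> (at z) (0, 0, a z))"
    proof (rule Bochner_Integration.integral_cong[OF refl])
      fix z
      show "f z * frechet_derivative \<phi> (at z) (1, snd (snd z), 0) =
        f z * frechet_derivative \<phi> (at z) (1, snd (snd z), a z) - f z * frechet_derivative \<phi> (at z) (0, 0, a z)"
        using linear_add[OF lin, of z "(1, snd (snd z), 0)" "(0, 0, a z)"] by (simp add: algebra_simps)
    qed
    also have "\<dots> = (LINT z|lborel. f z * frechet_derivative \<phi> (at z) (1, snd (snd z), a z))
        - (LINT z|lborel. f z * frechet_derivative \<phi> (at z) (0, 0, a z))"
    proof (rule Bochner_Integration.integral_diff[OF intD[OF a]])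
      have "f z * frechet_derivative \<phi> (at z) (0, 0, a z) =
        f z * frechet_derivative \<phi> (at z) (1, snd (snd z), a z) - f z * frechet_derivative \<phi> (at z) (1, snd (snd z), 0)" for z
        using linear_add[OF lin, of z "(1, snd (snd z), 0)" "(0, 0, a z)"] by (simp add: algebra_simps)
      then show "integrable lborel (\<lambda>z. f z * frechet_derivative \<phi> (at z) (0, 0, a z))"
        using Bochner_Integration.integrable_diff[OF intD[OF a] intD[OF continuous_on_const]] by simp
    qed
    also have "\<dots> = - (LINT z|lborel. f z powr m * laplacian_v \<phi> z)"
      using self_similar_transport[OF m A \<gamma> int \<phi> K \<phi>0]
        self_similar_diffusion[OF m A \<gamma> exponents \<phi> K \<phi>0]
      unfolding f_def a_def by simp
    also have "(LINT z|lborel. f z powr m * laplacian_v \<phi> z) =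
        (LINT z:positive_times|lborel. f z powr m * laplacian_v \<phi> z)"
      using L0 by (rule unrestrict[symmetric])
    finally show ?thesis by (simp add: f_def case_prod_unfold)
  qed
  then show ?thesis
    unfolding distributional_solution_def
    using loc[OF f(1)] loc[OF fm] by (simp add: f_def case_prod_unfold)
qed

lemma fundamental_solution_self_similar:
  assumes m: "0 < m" "m \<noteq> 1" and A: "0 < A" "A < 1" and \<gamma>: "(1 - m) * \<gamma> > 0"
    and exponents: "(1 + A) * (1 - m) * real CARD('n) = 3 * A - 1"
    and int: "integrable lborel (\<lambda>z. profile m A \<gamma> (fst z) (snd z :: real^'n))"
    and mass: "(LINT z|lborel. profile m A \<gamma> (fst z) (snd z :: real^'n)) = 1"
  shows "fundamental_solution m (self_similar m A \<gamma> :: real \<Rightarrow> real^'n \<Rightarrow> real^'n \<Rightarrow> real)"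
  unfolding fundamental_solution_def
proof (intro conjI allI impI)
  show "0 \<le> self_similar m A \<gamma> t x v" for t and x v :: "real^'n"
    by (simp add: self_similar_def profile_def)
  show "distributional_solution m (self_similar m A \<gamma> :: real \<Rightarrow> real^'n \<Rightarrow> real^'n \<Rightarrow> real)"
    by (rule distributional_solution_self_similar[OF m A \<gamma> exponents int])
  show "has_bochner_integral lborel (\<lambda>(x :: real^'n, v). self_similar m A \<gamma> t x v) 1"
    if "0 < t" for t
    using integral_self_similar[OF A that, of "\<lambda>_ :: (real^'n) \<times> (real^'n). 1" m \<gamma>] int mass
    by (simp add: has_bochner_integral_iff case_prod_unfold)
  fix \<psi> :: "(real^'n) \<times> (real^'n) \<Rightarrow> real"
  assume "continuous_on UNIV \<psi> \<and> bounded (range \<psi>)"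
  then show "((\<lambda>t. LINT (x, v)|lborel. self_similar m A \<gamma> t x v * \<psi> (x, v)) \<longlongrightarrow> \<psi> (0, 0)) (at_right 0)"
    using self_similar_concentrates[OF A int, of \<psi>] mass by (simp add: case_prod_unfold zero_prod_def)
qed

theorem lemma2:
  fixes d :: nat and m A :: real
  assumes d: "d = CARD('n::finite)"
    and m: "m > 0" "m \<noteq> 1" "3 - real d + real d * m \<noteq> 0"
    and A: "A = (1 + real d - real d * m) / (3 - real d + real d * m)"
  shows "(\<forall>\<gamma>. (1 - m) * \<gamma> > 0 \<longrightarrow>
           (integrable lborel (\<lambda>(x :: real^'n, v :: real^'n). profile m A \<gamma> x v) \<longleftrightarrow>
            m \<in> {1 - 1 / real d<..<1} \<union> {1<..<1 + 1 / real d})) \<and>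
         (m \<in> {1 - 1 / real d<..<1} \<union> {1<..<1 + 1 / real d} \<longrightarrow>
           (\<exists>!\<gamma>. (1 - m) * \<gamma> > 0 \<and>
              (LINT (x :: real^'n, v :: real^'n)|lborel. profile m A \<gamma> x v) = 1) \<and>
           (\<forall>\<gamma>. (1 - m) * \<gamma> > 0 \<and>
              (LINT (x :: real^'n, v :: real^'n)|lborel. profile m A \<gamma> x v) = 1 \<longrightarrow>
              fundamental_solution m
                (self_similar m A \<gamma> :: real \<Rightarrow> real^'n \<Rightarrow> real^'n \<Rightarrow> real)))"
proof -
  let ?range = "{1 - 1 / real d<..<1} \<union> {1<..<1 + 1 / real d}"
  have d0: "0 < d" using d by simp
  note range = exponent_bounds[OF d0 m(1) _ A]
  have integrable: "integrable lborel (\<lambda>z. profile m A \<gamma> (fst z) (snd z :: real^'n))"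
    if "m \<in> ?range" "(1 - m) * \<gamma> > 0" for \<gamma>
    using integrable_profile[OF m(1,2) _ range(1)[OF that(1)] that(2)] range(4)[OF that(1)] d by simp
  have "integrable lborel (\<lambda>z. profile m A \<gamma> (fst z) (snd z :: real^'n)) \<longleftrightarrow> m \<in> ?range"
    if "(1 - m) * \<gamma> > 0" for \<gamma>
    using integrable[OF _ that] not_integrable_profile[OF d m A that] by blast
  moreover have "\<exists>!\<gamma>. (1 - m) * \<gamma> > 0 \<and> (LINT z|lborel. profile m A \<gamma> (fst z) (snd z :: real^'n)) = 1"
    if "m \<in> ?range"
    using exists_unique_unit_mass[OF m(1,2) _ _ range(1)[OF that]] range(4,5)[OF that] d by simp
  moreover have "fundamental_solution m (self_similar m A \<gamma> :: real \<Rightarrow> real^'n \<Rightarrow> real^'n \<Rightarrow> real)"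
    if "m \<in> ?range" "(1 - m) * \<gamma> > 0" "(LINT z|lborel. profile m A \<gamma> (fst z) (snd z :: real^'n)) = 1" for \<gamma>
    using range(3)[OF that(1)] d
    by (intro fundamental_solution_self_similar m(1,2) range(1,2) that integrable) simp_all
  ultimately show ?thesis unfolding case_prod_unfold by blast
qed

end
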